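(* Let $\lambda\in(0,1)$, let $d\ge2$ be an integer, and let $(G_N)_{N\ge1}$ be a sequence of bipartite compatibility graphs with $\rho(G_N)\le\rho_0<1$ for all $N\ge1$, where $\rho_0$ does not depend on $N$. Assume $\max\{\phi(G_N)^2,\gamma(G_N)\}\to0$ as $N\to\infty$. Then $$\sum_{i=1}^\infty\mathbb{E}\left[\left(q_i^N(\infty)-q_i^*\right)^2\right]\to0\quad\text{as }N\to\infty,$$ where $q_i^*=\lambda^{\frac{d^i-1}{d-1}}$.
   Context: Model. Fix $\lambda\in(0,1)$ and an integer $d\ge2$. $G_N=(V_N,W_N,E_N)$ is a finite bipartite graph, with $V_N$ the set of servers, $|V_N|=N$, $W_N$ the set of task types (dispatchers), $|W_N|=M(N)$, and $E_N\subseteq V_N\times W_N$. For $v\in V_N$ let $\mathcal{N}_v=\{w\in W_N:(v,w)\in E_N\}$, $d_v^N=|\mathcal{N}_v|$; for $w\in W_N$ let $\mathcal{N}_w=\{v\in V_N:(v,w)\in E_N\}$, $d_w^N=|\mathcal{N}_w|$; assume $d_w^N\ge1$ for all $w$. Tasks of each type arrive according to independent Poisson processes of rate $\lambda N/M(N)$ each, and each task has an independent exponential service time of mean one. When a task of type $w$ arrives, $d$ servers are sampled uniformly at random with replacement from $\mathcal{N}_w$, and the task joins the shortest queue among the sampled servers, ties broken uniformly at random. Each server serves its queue one task at a time, first come first served. $X_v(t)\in\{0,1,2,\dots\}$ is the queue length (including any task in service) of server $v$ at time $t$; $\boldsymbol{X}(t)=(X_v(t))_{v\in V_N}$ is a continuous-time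 Markov chain, which has a unique stationary distribution when $\rho(G_N)<1$. Graph quantities: $$\rho(G_N)=\max_{v\in V_N}\frac{\lambda N}{M(N)}\sum_{w\in\mathcal{N}_v}\frac1{d_w^N},\quad \phi(G_N)=\max_{v\in V_N}\left|\frac{N}{M(N)}\sum_{w\in\mathcal{N}_v}\frac1{d_w^N}-1\right|,\quad \gamma(G_N)=\frac1{M(N)}\sum_{w\in W_N}\frac1{d_w^N}.$$ Occupancy: $q_i^N(t)=\frac1N\sum_{v\in V_N}\mathbf{1}\{X_v(t)\ge i\}$, and $(q_i^N(\infty))_{i\ge1}$ denotes this functional evaluated on $\boldsymbol{X}(\infty)$, a random vector having the stationary distribution of $\boldsymbol{X}$. *)

theory Defs
  imports "HOL-Probability.Probability"
begin

section \<open>Bipartite compatibility graphs\<close>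

record ('v, 'w) compat_graph =
  servers :: "'v set"
  task_types :: "'w set"
  edges :: "('v \<times> 'w) set"

definition server_nbrs :: "('v, 'w) compat_graph \<Rightarrow> 'v \<Rightarrow> 'w set" where
  "server_nbrs G v = {w \<in> task_types G. (v, w) \<in> edges G}"

definition type_nbrs :: "('v, 'w) compat_graph \<Rightarrow> 'w \<Rightarrow> 'v set" where
  "type_nbrs G w = {v \<in> servers G. (v, w) \<in> edges G}"

definition compatibility_graph :: "('v, 'w) compat_graph \<Rightarrow> bool" where
  "compatibility_graph G \<longleftrightarrow>
     finite (servers G) \<and> servers G \<noteq> {} \<and>
     finite (task_types G) \<and> task_types G \<noteq> {} \<and>
     edges G \<subseteq> servers G \<times> task_types G \<and>
     (\<forall>w \<in> task_types G. card (type_nbrs G w) \<ge> 1)"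

definition rho :: "real \<Rightarrow> ('v, 'w) compat_graph \<Rightarrow> real" where
  "rho lam G =
     (MAX v \<in> servers G.
        lam * real (card (servers G)) / real (card (task_types G)) *
        (\<Sum>w \<in> server_nbrs G v. 1 / real (card (type_nbrs G w))))"

definition phi :: "('v, 'w) compat_graph \<Rightarrow> real" where
  "phi G =
     (MAX v \<in> servers G.
        \<bar>real (card (servers G)) / real (card (task_types G)) *
         (\<Sum>w \<in> server_nbrs G v. 1 / real (card (type_nbrs G w))) - 1\<bar>)"

definition gamma :: "('v, 'w) compat_graph \<Rightarrow> real" where
  "gamma G =
     1 / real (card (task_types G)) *
     (\<Sum>w \<in> task_types G. 1 / real (card (type_nbrs G w)))"


section \<open>Continuous-time Markov chains on a countable state space\<close>

text \<open>
  \<open>rate x y\<close> is the jump rate from \<open>x\<close> to \<open>y\<close> for \<open>x \<noteq> y\<close>; values on the diagonal are ignored.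
  The rates out of each state are assumed summable (otherwise the infinite sum is 0 by convention).
\<close>

definition generator :: "'s set \<Rightarrow> ('s \<Rightarrow> 's \<Rightarrow> real) \<Rightarrow> 's \<Rightarrow> 's \<Rightarrow> real" where
  "generator S rate x y =
     (if x = y then - (\<Sum>\<^sub>\<infinity> z \<in> S - {x}. rate x z) else rate x y)"

text \<open>
  \<open>P t x\<close> is the law at time \<open>t\<close> of the chain started in \<open>x\<close>. The clauses are honesty (each
  \<open>P t x\<close> is a probability distribution on \<open>S\<close>), the Chapman-Kolmogorov equations, and
  \<open>P'(0) = Q\<close> entrywise. When the rates out of the states are bounded, these determine \<open>P\<close>
  on \<open>S\<close> for all \<open>t \<ge> 0\<close>.
\<close>

definition ctmc_transition_function ::
    "'s set \<Rightarrow> ('s \<Rightarrow> 's \<Rightarrow> real) \<Rightarrow> (real \<Rightarrow> 's \<Rightarrow> 's pmf) \<Rightarrow> bool" where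
  "ctmc_transition_function S rate P \<longleftrightarrow>
     (\<forall>t \<ge> 0. \<forall>x \<in> S. set_pmf (P t x) \<subseteq> S) \<and>
     (\<forall>x \<in> S. P 0 x = return_pmf x) \<and>
     (\<forall>s \<ge> 0. \<forall>t \<ge> 0. \<forall>x \<in> S. P (s + t) x = bind_pmf (P s x) (P t)) \<and>
     (\<forall>x \<in> S. \<forall>y \<in> S.
        ((\<lambda>t. pmf (P t x) y) has_real_derivative generator S rate x y) (at 0 within {0..}))"

definition stationary_distribution :: "'s set \<Rightarrow> ('s \<Rightarrow> 's \<Rightarrow> real) \<Rightarrow> 's pmf \<Rightarrow> bool" where
  "stationary_distribution S rate p \<longleftrightarrow>
     set_pmf p \<subseteq> S \<and>
     (\<exists>P. ctmc_transition_function S rate P \<and> (\<forall>t \<ge> 0. bind_pmf p (P t) = p))"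


section \<open>The queue length process\<close>

definition queue_states :: "('v, 'w) compat_graph \<Rightarrow> ('v \<Rightarrow> nat) set" where
  "queue_states G = servers G \<rightarrow>\<^sub>E UNIV"

text \<open>
  The server joined by an arriving task of type \<open>w\<close> in state \<open>x\<close>. Ties are broken uniformly over
  the distinct shortest servers in the sample; weighting them by multiplicity instead gives the
  same law, as compatible servers with equal queue lengths are exchangeable.
\<close>

definition joined_server ::
    "nat \<Rightarrow> ('v, 'w) compat_graph \<Rightarrow> ('v \<Rightarrow> nat) \<Rightarrow> 'w \<Rightarrow> 'v pmf" where
  "joined_server d G x w =
     do {
       vs \<leftarrow> replicate_pmf d (pmf_of_set (type_nbrs G w));
       pmf_of_set {v \<in> set vs. \<forall>u \<in> set vs. x v \<le> x u}
     }"

definition queue_rate ::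
    "real \<Rightarrow> nat \<Rightarrow> ('v, 'w) compat_graph \<Rightarrow> ('v \<Rightarrow> nat) \<Rightarrow> ('v \<Rightarrow> nat) \<Rightarrow> real" where
  "queue_rate lam d G x y =
     (\<Sum>w \<in> task_types G. \<Sum>v \<in> servers G.
        if y = x(v := x v + 1)
        then lam * real (card (servers G)) / real (card (task_types G)) *
             pmf (joined_server d G x w) v
        else 0) +
     (\<Sum>v \<in> servers G. if x v > 0 \<and> y = x(v := x v - 1) then 1 else 0)"

definition occupancy :: "('v, 'w) compat_graph \<Rightarrow> nat \<Rightarrow> ('v \<Rightarrow> nat) \<Rightarrow> real" where
  "occupancy G i x = 1 / real (card (servers G)) * (\<Sum>v \<in> servers G. of_bool (x v \<ge> i))"

definition q_star :: "real \<Rightarrow> nat \<Rightarrow> nat \<Rightarrow> real" where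
  "q_star lam d i = lam powr ((real d ^ i - 1) / (real d - 1))"

end

theory Submission
  imports Defs
begin

text \<open>
  The proof works in stationarity throughout and uses the Markov chain only through one fact: a
  stationary law annihilates the generator on bounded functions
  (\<open>stationary_expectation_generator_eq_0\<close>). For a task type \<open>w\<close> let \<open>q_i^w\<close> be the fraction of
  the servers compatible with \<open>w\<close> whose queue length is at least \<open>i\<close>, and write \<open>Av\<close> for the
  average over task types. The parameter \<open>phi\<close> controls how far \<open>Av q_i^w\<close> is from the global
  occupancy \<open>q_i\<close>, and \<open>gamma\<close> controls the noise of a typical \<open>q_i^w\<close>.

  Since a task of type \<open>w\<close> joins a server of length at least \<open>i\<close> with probability \<open>(q_i^w)^d\<close>, the
  generator applied to \<open>q_i\<close> gives the balance \<open>E q_(i+1) = \<lambda> E Av (q_i^w)^d\<close>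
  (\<open>mean_occ_balance\<close>). In particular \<open>E q_i\<close> decays geometrically, uniformly in \<open>N\<close>, and once
  \<open>q_i^w\<close> is known to be close to the constant \<open>q_i*\<close> for most \<open>w\<close>, it follows that
  \<open>E q_(i+1)\<close> is close to \<open>\<lambda> (q_i*)^d = q_(i+1)*\<close>. So it remains to prevent the local occupancies
  from fluctuating, and by the identity \<open>|y| = y + 2 max 0 (-y)\<close> with \<open>y = q_i^w - q_i*\<close> it is
  enough to bound them from below: if \<open>E q_i\<close> converges to \<open>q_i*\<close> and the shortfall
  \<open>E Av max 0 (q_i* - q_i^w)\<close> vanishes, then \<open>E Av |q_i^w - q_i*|\<close> vanishes.

  For the lower bound let \<open>l_i\<close> be the largest number whose shortfall at level \<open>i\<close> vanishes as
  \<open>N\<close> grows. The arrival intensity at a server is increasing in the local occupancies, so the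
  generator applied to \<open>Av (max 0 (b - q_i^w))^2\<close> shows that any \<open>b\<close> at which the fluid drift,
  with the occupancies replaced by \<open>l\<close>, is zero is itself asymptotically a lower bound
  (\<open>queue_drift_sq_shortfall\<close>). This says that \<open>\<lambda> (l_(i-1)^d - l_i^d) \<le> l_i - l_(i+1)\<close>. Summing
  over all levels from \<open>i\<close> on, where the geometric decay disposes of the boundary term at
  infinity, yields \<open>\<lambda> l_(i-1)^d \<le> l_i\<close>, and hence \<open>q_i* \<le> l_i\<close> (\<open>q_star_le_level\<close>). Finally
  the geometric bound dominates the series over \<open>i\<close>.
\<close>

section \<open>Stationary laws annihilate the generator\<close>

lemma integrable_pmf_bounded:
  fixes f :: "'a \<Rightarrow> real"
  assumes "\<And>x. x \<in> set_pmf p \<Longrightarrow> \<bar>f x\<bar> \<le> B"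
  shows "integrable (measure_pmf p) f"
  by (rule measure_pmf.integrable_const_bound[where B = B]) (auto simp: AE_measure_pmf_iff assms)

lemma expectation_bind_pmf:
  fixes f :: "'b \<Rightarrow> real"
  assumes "\<And>y. \<bar>f y\<bar> \<le> B"
  shows "measure_pmf.expectation (bind_pmf p K) f =
    measure_pmf.expectation p (\<lambda>x. measure_pmf.expectation (K x) f)"
  unfolding measure_pmf_bind
  by (rule integral_bind[where K = "count_space UNIV" and B = B and B' = 1])
     (auto simp: assms measure_pmf.emeasure_space_1 space_subprob_algebra
      intro!: prob_space_imp_subprob_space measure_pmf.prob_space_axioms)

lemma tendsto_diff_quotient_at_zero:
  fixes g :: "real \<Rightarrow> real"
  assumes "(g has_real_derivative D) (at 0 within {0..})" and "t > 0"
  shows "(\<lambda>n. (g (t / real (Suc n)) - g 0) / (t / real (Suc n))) \<longlonglongrightarrow> D"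
proof -
  have "((\<lambda>y. (g y - g 0) / (y - 0)) \<longlongrightarrow> D) (at 0 within {0..})"
    using assms(1) by (simp add: has_field_derivative_iff)
  moreover have "filterlim (\<lambda>n. t / real (Suc n)) (at 0 within {0..}) sequentially"
    unfolding filterlim_at
  proof
    show "\<forall>\<^sub>F n in sequentially. t / real (Suc n) \<in> {0..} \<and> t / real (Suc n) \<noteq> 0"
      using assms(2) by auto
    show "(\<lambda>n. t / real (Suc n)) \<longlonglongrightarrow> 0"
      using LIMSEQ_inverse_real_of_nat tendsto_mult_right_zero
      by (fastforce simp: divide_inverse)
  qed
  ultimately show ?thesis
    using filterlim_compose by fastforce
qed

text \<open>
  By Chapman-Kolmogorov, one way to be in \<open>x\<close> at time \<open>n s\<close> is to be there at each multiple of \<open>s\<close>.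
\<close>

lemma ctmc_stay_ge_power:
  assumes P: "ctmc_transition_function S rate P" and x: "x \<in> S" and s: "s \<ge> 0"
  shows "pmf (P (real n * s) x) x \<ge> pmf (P s x) x ^ n"
proof (induction n)
  case 0
  then show ?case using P x by (simp add: ctmc_transition_function_def)
next
  case (Suc n)
  have "P (real (Suc n) * s) x = bind_pmf (P s x) (P (real n * s))"
    using P x s unfolding ctmc_transition_function_def
    by (metis add.commute distrib_right mult_1 mult_nonneg_nonneg of_nat_0_le_iff of_nat_Suc)
  hence "pmf (P (real (Suc n) * s) x) x =
     measure_pmf.expectation (P s x) (\<lambda>y. pmf (P (real n * s) y) x)"
    by (simp add: pmf_bind)
  also have "\<dots> \<ge> measure_pmf.expectation (P s x) (\<lambda>y. pmf (P (real n * s) x) x * indicator {x} y)"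
    by (intro integral_mono integrable_pmf_bounded[where B = 1])
       (auto simp: pmf_le_1 indicator_def abs_mult)
  also have "measure_pmf.expectation (P s x) (\<lambda>y. pmf (P (real n * s) x) x * indicator {x} y)
      = pmf (P (real n * s) x) x * pmf (P s x) x"
    by (simp add: pmf.rep_eq)
  finally have "pmf (P (real (Suc n) * s) x) x \<ge> pmf (P (real n * s) x) x * pmf (P s x) x" .
  moreover have "pmf (P (real n * s) x) x * pmf (P s x) x \<ge> pmf (P s x) x ^ n * pmf (P s x) x"
    using Suc by (intro mult_right_mono) auto
  ultimately show ?case by (simp add: mult.commute)
qed

text \<open>
  A linear lower bound valid for every \<open>t\<close>, although the definition only provides the derivative
  at zero: Bernoulli's inequality turns the \<open>n\<close>-th power of the probability of staying for
  \<open>t / n\<close> into a difference quotient at zero. The uniformity in \<open>x\<close> that this gives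
  for bounded rates is what permits dominated convergence below.
\<close>

lemma ctmc_stay_ge:
  assumes P: "ctmc_transition_function S rate P" and x: "x \<in> S" and t: "t > 0"
  shows "pmf (P t x) x \<ge> 1 + t * generator S rate x x"
proof -
  define g where "g = (\<lambda>s. pmf (P s x) x)"
  have g0: "g 0 = 1" using P x by (simp add: ctmc_transition_function_def g_def)
  have "(g has_real_derivative generator S rate x x) (at 0 within {0..})"
    using P x unfolding ctmc_transition_function_def g_def by blast
  hence lim: "(\<lambda>n. (g (t / real (Suc n)) - g 0) / (t / real (Suc n))) \<longlonglongrightarrow> generator S rate x x"
    using t by (rule tendsto_diff_quotient_at_zero)
  have "1 + t * ((g (t / real (Suc n)) - g 0) / (t / real (Suc n))) \<le> g t" for n
  proof -
    have "1 + real (Suc n) * (g (t / real (Suc n)) - 1) \<le> (1 + (g (t / real (Suc n)) - 1)) ^ Suc n"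
      by (rule Bernoulli_inequality) (simp add: g_def)
    also have "\<dots> \<le> g t"
      using ctmc_stay_ge_power[OF P x, of "t / real (Suc n)" "Suc n"] t by (simp add: g_def)
    finally show ?thesis using t g0 by (simp add: mult.commute)
  qed
  moreover have "(\<lambda>n. 1 + t * ((g (t / real (Suc n)) - g 0) / (t / real (Suc n))))
      \<longlonglongrightarrow> 1 + t * generator S rate x x"
    by (intro tendsto_intros lim)
  ultimately show ?thesis
    unfolding g_def by (intro LIMSEQ_le_const2) auto
qed

text \<open>
  Stationarity makes the expected difference quotients \<open>(P_t f - f) / t\<close> vanish, so the task is to
  let \<open>t\<close> tend to zero under the expectation. The quotients are bounded since the chain leaves its
  state by time \<open>t\<close> with probability at most \<open>C t\<close>. They converge in each state \<open>x\<close> because the mass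
  that \<open>P_t\<close> puts outside \<open>x\<close> and its finitely many targets \<open>F x\<close> is of order \<open>o(t)\<close>: the
  derivatives at zero of the masses of \<open>x\<close> and of its targets add up to zero.
\<close>

lemma stationary_expectation_generator_eq_0:
  fixes f :: "'s \<Rightarrow> real"
  assumes st: "stationary_distribution S rate p"
    and F: "\<And>x. x \<in> S \<Longrightarrow> finite (F x) \<and> F x \<subseteq> S - {x} \<and> (\<forall>y \<in> S - {x} - F x. rate x y = 0)"
    and C: "\<And>x. x \<in> S \<Longrightarrow> (\<Sum>y \<in> F x. rate x y) \<le> C"
    and B: "\<And>x. \<bar>f x\<bar> \<le> B"
  shows "integrable (measure_pmf p) (\<lambda>x. \<Sum>y \<in> F x. rate x y * (f y - f x))"
    and "measure_pmf.expectation p (\<lambda>x. \<Sum>y \<in> F x. rate x y * (f y - f x)) = 0"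
proof -
  obtain P where P: "ctmc_transition_function S rate P"
    and stP: "\<And>t. t \<ge> 0 \<Longrightarrow> bind_pmf p (P t) = p" and pS: "set_pmf p \<subseteq> S"
    using st unfolding stationary_distribution_def by blast
  have B0: "0 \<le> B" using B[of undefined] by linarith
  define t where "t n = 1 / real (Suc n)" for n
  have t: "t n > 0" for n by (simp add: t_def)
  define s where "s n x = (measure_pmf.expectation (P (t n) x) f - f x) / t n" for n x
  have gen: "generator S rate x x = - (\<Sum>y \<in> F x. rate x y)" if "x \<in> S" for x
  proof -
    have "(\<Sum>\<^sub>\<infinity> z \<in> S - {x}. rate x z) = (\<Sum>\<^sub>\<infinity> z \<in> F x. rate x z)"
      using F[OF that] by (intro infsum_cong_neutral) auto
    thus ?thesis using F[OF that] by (simp add: generator_def)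
  qed
  have stay: "1 - pmf (P (t n) x) x \<le> t n * (\<Sum>y \<in> F x. rate x y)" if "x \<in> S" for n x
    using ctmc_stay_ge[OF P that t[of n]] gen[OF that] by simp
  \<comment> \<open>Keep the terms of the targets in \<open>A\<close>; the rest is bounded by the mass outside \<open>insert x A\<close>.\<close>
  have split: "\<bar>measure_pmf.expectation (P (t n) x) f - f x
       - (\<Sum>y \<in> A. pmf (P (t n) x) y * (f y - f x))\<bar>
      \<le> 2 * B * (1 - pmf (P (t n) x) x - (\<Sum>y \<in> A. pmf (P (t n) x) y))"
    if "x \<in> S" "finite A" "x \<notin> A" for n x A
  proof -
    let ?E = "measure_pmf.expectation (P (t n) x)"
    have int: "integrable (measure_pmf (P (t n) x)) f"
      by (rule integrable_pmf_bounded[OF B])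
    have diff2: "\<bar>f y - f x\<bar> \<le> 2 * B" for y using B[of x] B[of y] by linarith
    have int2: "integrable (measure_pmf (P (t n) x)) (\<lambda>y. indicator A y * (f y - f x))"
      using diff2 B0 by (intro integrable_pmf_bounded[where B = "2 * B"]) (auto simp: indicator_def)
    have "?E (\<lambda>y. indicator A y * (f y - f x)) = (\<Sum>y \<in> A. pmf (P (t n) x) y * (f y - f x))"
      using that by (subst integral_measure_pmf_real[where A = A])
        (auto simp: indicator_def mult.commute intro!: sum.cong)
    moreover have "?E (\<lambda>y. f y - f x) = ?E f - f x"
      using int by simp
    ultimately have "?E f - f x - (\<Sum>y \<in> A. pmf (P (t n) x) y * (f y - f x))
      = ?E (\<lambda>y. (f y - f x) - indicator A y * (f y - f x))"
      using int int2 by (simp add: Bochner_Integration.integral_diff)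
    also have "\<bar>\<dots>\<bar> \<le> ?E (\<lambda>y. \<bar>(f y - f x) - indicator A y * (f y - f x)\<bar>)"
      by (rule integral_abs_bound)
    also have "\<dots> \<le> ?E (\<lambda>y. 2 * B * (1 - indicator (insert x A) y))"
    proof (intro integral_mono integrable_pmf_bounded[where B = "2 * B"])
      fix y
      show "\<bar>(f y - f x) - indicator A y * (f y - f x)\<bar> \<le> 2 * B * (1 - indicator (insert x A) y)"
        and "\<bar>\<bar>(f y - f x) - indicator A y * (f y - f x)\<bar>\<bar> \<le> 2 * B"
        using B0 diff2[of y] by (auto simp: indicator_def)
      show "\<bar>2 * B * (1 - indicator (insert x A) y)\<bar> \<le> 2 * B"
        using B0 by (auto simp: indicator_def)
    qed
    also have "\<dots> = 2 * B * (1 - measure_pmf.prob (P (t n) x) (insert x A))"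
      by (simp add: Bochner_Integration.integral_diff integrable_pmf_bounded[where B = 1])
    also have "measure_pmf.prob (P (t n) x) (insert x A)
        = pmf (P (t n) x) x + (\<Sum>y \<in> A. pmf (P (t n) x) y)"
      using that by (subst measure_measure_pmf_finite) auto
    finally show ?thesis by (simp add: algebra_simps)
  qed
  have lim: "(\<lambda>n. s n x) \<longlonglongrightarrow> (\<Sum>y \<in> F x. rate x y * (f y - f x))" if x: "x \<in> S" for x
  proof -
    have Fx: "finite (F x)" "F x \<subseteq> S - {x}" "x \<notin> F x" using F[OF x] by auto
    have ent: "(\<lambda>n. (pmf (P (t n) x) y - of_bool (y = x)) / t n) \<longlonglongrightarrow> generator S rate x y"
      if "y \<in> S" for y
    proof -
      have "((\<lambda>t. pmf (P t x) y) has_real_derivative generator S rate x y) (at 0 within {0..})"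
        using P x that unfolding ctmc_transition_function_def by blast
      moreover have "P 0 x = return_pmf x"
        using P x by (simp add: ctmc_transition_function_def)
      ultimately show ?thesis
        using tendsto_diff_quotient_at_zero[of "\<lambda>t. pmf (P t x) y" "generator S rate x y" 1]
        by (cases "y = x") (simp_all add: t_def)
    qed
    have entF: "(\<lambda>n. pmf (P (t n) x) y / t n) \<longlonglongrightarrow> rate x y" if "y \<in> F x" for y
    proof -
      have "y \<in> S" "y \<noteq> x" using that Fx by auto
      thus ?thesis using ent[of y] by (simp add: generator_def)
    qed
    have entx: "(\<lambda>n. (1 - pmf (P (t n) x) x) / t n) \<longlonglongrightarrow> (\<Sum>y \<in> F x. rate x y)"
      using tendsto_minus[OF ent[OF x]] gen[OF x] by (simp add: minus_divide_left)
    have main: "(\<lambda>n. \<Sum>y \<in> F x. pmf (P (t n) x) y / t n * (f y - f x))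
        \<longlonglongrightarrow> (\<Sum>y \<in> F x. rate x y * (f y - f x))"
      by (intro tendsto_intros entF)
    have "(\<lambda>n. 2 * B * ((1 - pmf (P (t n) x) x) / t n - (\<Sum>y \<in> F x. pmf (P (t n) x) y / t n)))
        \<longlonglongrightarrow> 2 * B * ((\<Sum>y \<in> F x. rate x y) - (\<Sum>y \<in> F x. rate x y))"
      by (intro tendsto_intros entF entx)
    \<comment> \<open>The mass outside \<open>x\<close> and its targets, divided by \<open>t\<close>, tends to zero.\<close>
    hence rem: "(\<lambda>n. 2 * B * ((1 - pmf (P (t n) x) x) / t n - (\<Sum>y \<in> F x. pmf (P (t n) x) y / t n)))
        \<longlonglongrightarrow> 0" by simp
    have "(\<lambda>n. s n x - (\<Sum>y \<in> F x. pmf (P (t n) x) y / t n * (f y - f x))) \<longlonglongrightarrow> 0"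
    proof (rule tendsto_rabs_zero_cancel, rule tendsto_sandwich[OF _ _ tendsto_const rem])
      have "\<bar>s n x - (\<Sum>y \<in> F x. pmf (P (t n) x) y / t n * (f y - f x))\<bar>
        \<le> 2 * B * ((1 - pmf (P (t n) x) x) / t n - (\<Sum>y \<in> F x. pmf (P (t n) x) y / t n))" for n
      proof -
        have eq: "s n x - (\<Sum>y \<in> F x. pmf (P (t n) x) y / t n * (f y - f x)) =
          (measure_pmf.expectation (P (t n) x) f - f x
           - (\<Sum>y \<in> F x. pmf (P (t n) x) y * (f y - f x))) / t n"
          by (simp add: s_def diff_divide_distrib sum_divide_distrib)
        have "\<bar>s n x - (\<Sum>y \<in> F x. pmf (P (t n) x) y / t n * (f y - f x))\<bar> \<le>
          2 * B * (1 - pmf (P (t n) x) x - (\<Sum>y \<in> F x. pmf (P (t n) x) y)) / t n"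
          unfolding eq abs_divide using t[of n] split[OF x Fx(1,3), of n]
          by (simp add: divide_right_mono)
        thus ?thesis by (simp add: diff_divide_distrib right_diff_distrib flip: sum_divide_distrib)
      qed
      thus "\<forall>\<^sub>F n in sequentially. \<bar>s n x - (\<Sum>y \<in> F x. pmf (P (t n) x) y / t n * (f y - f x))\<bar>
        \<le> 2 * B * ((1 - pmf (P (t n) x) x) / t n - (\<Sum>y \<in> F x. pmf (P (t n) x) y / t n))" by simp
    qed simp
    from tendsto_add[OF this main] show ?thesis by simp
  qed
  have s0: "measure_pmf.expectation p (s n) = 0" for n
  proof -
    have "\<bar>measure_pmf.expectation (P (t n) x) f\<bar> \<le> B" for x
    proof -
      have "\<bar>measure_pmf.expectation (P (t n) x) f\<bar> \<le> measure_pmf.expectation (P (t n) x) (\<lambda>_. B)"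
        by (intro order_trans[OF integral_abs_bound] integral_mono integrable_pmf_bounded[where B = B])
           (auto simp: B B0)
      thus ?thesis by simp
    qed
    hence "measure_pmf.expectation p (s n) =
       (measure_pmf.expectation p (\<lambda>x. measure_pmf.expectation (P (t n) x) f)
         - measure_pmf.expectation p f) / t n"
      unfolding s_def using B
      by (subst integral_divide_zero, subst Bochner_Integration.integral_diff)
         (auto intro!: integrable_pmf_bounded)
    also have "measure_pmf.expectation p (\<lambda>x. measure_pmf.expectation (P (t n) x) f)
       = measure_pmf.expectation p f"
      using expectation_bind_pmf[of f B p "P (t n)", OF B] stP[of "t n"] t[of n] by simp
    finally show ?thesis by simp
  qed
  have lim': "AE x in measure_pmf p. (\<lambda>n. s n x) \<longlonglongrightarrow> (\<Sum>y \<in> F x. rate x y * (f y - f x))"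
    using lim pS by (auto simp: AE_measure_pmf_iff)
  have bound: "AE x in measure_pmf p. norm (s n x) \<le> 2 * B * C" for n
    unfolding AE_measure_pmf_iff
  proof
    fix x assume "x \<in> set_pmf p"
    hence x: "x \<in> S" using pS by auto
    have "norm (s n x) \<le> 2 * B * (1 - pmf (P (t n) x) x) / t n"
      unfolding s_def real_norm_def abs_divide using t[of n] split[OF x, of "{}" n]
      by (simp add: divide_right_mono)
    also have "\<dots> \<le> 2 * B * (t n * (\<Sum>y \<in> F x. rate x y)) / t n"
      using stay[OF x, of n] t[of n] B0 by (intro divide_right_mono mult_left_mono) auto
    also have "\<dots> = 2 * B * (\<Sum>y \<in> F x. rate x y)" using t[of n] by simp
    also have "\<dots> \<le> 2 * B * C" using C[OF x] B0 by (intro mult_left_mono) auto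
    finally show "norm (s n x) \<le> 2 * B * C" .
  qed
  show "integrable (measure_pmf p) (\<lambda>x. \<Sum>y \<in> F x. rate x y * (f y - f x))"
    by (rule integrable_dominated_convergence[OF _ _ _ lim' bound]) auto
  have "(\<lambda>n. measure_pmf.expectation p (s n)) \<longlonglongrightarrow>
     measure_pmf.expectation p (\<lambda>x. \<Sum>y \<in> F x. rate x y * (f y - f x))"
    by (rule integral_dominated_convergence[OF _ _ _ lim' bound]) auto
  with s0 show "measure_pmf.expectation p (\<lambda>x. \<Sum>y \<in> F x. rate x y * (f y - f x)) = 0"
    by (simp add: LIMSEQ_const_iff)
qed

section \<open>The server joined by an arriving task\<close>

text \<open>
  The divided difference \<open>(s^d - t^d) / (s - t)\<close>, as a polynomial so that it is also meaningful at
  \<open>s = t\<close> and visibly increasing in both arguments. It is the factor by which sampling \<open>d\<close> servers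
  changes the chance that a server of a given queue length is joined, compared with joining a
  uniformly chosen compatible server.
\<close>

definition power_slope :: "nat \<Rightarrow> real \<Rightarrow> real \<Rightarrow> real" where
  "power_slope d s t = (\<Sum>i<d. t ^ (d - Suc i) * s ^ i)"

lemma power_slope_mult: "(s - t) * power_slope d s t = s ^ d - t ^ d"
  unfolding power_slope_def by (rule power_diff_sumr2[symmetric])

lemma power_slope_nonneg: "0 \<le> s \<Longrightarrow> 0 \<le> t \<Longrightarrow> 0 \<le> power_slope d s t"
  unfolding power_slope_def by (intro sum_nonneg) auto

lemma power_slope_le: 
  assumes "0 \<le> s" "s \<le> 1" "0 \<le> t" "t \<le> 1"
  shows "power_slope d s t \<le> real d"
proof -
  have "power_slope d s t \<le> (\<Sum>i<d. 1)"
    unfolding power_slope_def using assms by (intro sum_mono mult_le_one power_le_one) auto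
  thus ?thesis by simp
qed

lemma power_le_power_add_shortfall:
  fixes s \<sigma> :: real
  assumes "0 \<le> s" "0 \<le> \<sigma>" "\<sigma> \<le> 1"
  shows "\<sigma> ^ n \<le> s ^ n + real n * max 0 (\<sigma> - s)"
proof (induction n)
  case (Suc n)
  show ?case
  proof (cases "\<sigma> \<le> s")
    case True
    thus ?thesis using power_mono[OF True, of "Suc n"] assms by simp
  next
    case False
    have "\<sigma> ^ Suc n = \<sigma> * \<sigma> ^ n" by simp
    also have "\<dots> \<le> \<sigma> * (s ^ n + real n * max 0 (\<sigma> - s))"
      using Suc assms by (intro mult_left_mono) auto
    also have "\<dots> = s * s ^ n + (\<sigma> - s) * s ^ n + \<sigma> * (real n * (\<sigma> - s))"
      using False by (simp add: algebra_simps)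
    also have "(\<sigma> - s) * s ^ n \<le> (\<sigma> - s) * 1"
      using False assms by (intro mult_left_mono power_le_one) auto
    also have "\<sigma> * (real n * (\<sigma> - s)) \<le> 1 * (real n * (\<sigma> - s))"
      using False assms by (intro mult_right_mono) auto
    finally show ?thesis using False by (simp add: algebra_simps)
  qed
qed simp

text \<open>
  A one-sided Lipschitz bound: since the slope is increasing in both arguments, only the amounts by
  which \<open>s\<close> and \<open>t\<close> fall short of \<open>\<sigma>\<close> and \<open>\<tau>\<close> can make it smaller.
\<close>

lemma power_slope_shortfall:
  assumes "0 \<le> s" "s \<le> 1" "0 \<le> t" "t \<le> 1" "0 \<le> \<sigma>" "\<sigma> \<le> 1" "0 \<le> \<tau>" "\<tau> \<le> 1"
  shows "power_slope d \<sigma> \<tau> \<le> power_slope d s t + real (d * d) * (max 0 (\<sigma> - s) + max 0 (\<tau> - t))"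
proof -
  have "power_slope d \<sigma> \<tau> \<le> (\<Sum>i<d. t ^ (d - Suc i) * s ^ i + real d * (max 0 (\<sigma> - s) + max 0 (\<tau> - t)))"
    unfolding power_slope_def
  proof (rule sum_mono)
    fix i assume "i \<in> {..<d}"
    hence i: "i < d" by simp
    let ?j = "d - Suc i"
    have "\<tau> ^ ?j * \<sigma> ^ i \<le> (t ^ ?j + real ?j * max 0 (\<tau> - t)) * \<sigma> ^ i"
      using power_le_power_add_shortfall[of t \<tau> ?j] assms by (intro mult_right_mono) auto
    also have "\<dots> = t ^ ?j * \<sigma> ^ i + (real ?j * max 0 (\<tau> - t)) * \<sigma> ^ i" by (simp add: algebra_simps)
    also have "t ^ ?j * \<sigma> ^ i \<le> t ^ ?j * (s ^ i + real i * max 0 (\<sigma> - s))"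
      using power_le_power_add_shortfall[of s \<sigma> i] assms by (intro mult_left_mono) auto
    also have "\<dots> = t ^ ?j * s ^ i + t ^ ?j * (real i * max 0 (\<sigma> - s))" by (simp add: algebra_simps)
    also have "t ^ ?j * (real i * max 0 (\<sigma> - s)) \<le> 1 * (real d * max 0 (\<sigma> - s))"
      using assms i by (intro mult_mono power_le_one) auto
    also have "(real ?j * max 0 (\<tau> - t)) * \<sigma> ^ i \<le> (real d * max 0 (\<tau> - t)) * 1"
      using assms i by (intro mult_mono power_le_one) auto
    finally show "\<tau> ^ ?j * \<sigma> ^ i \<le> t ^ ?j * s ^ i + real d * (max 0 (\<sigma> - s) + max 0 (\<tau> - t))"
      by (simp add: algebra_simps)
  qed
  also have "\<dots> = power_slope d s t + real (d * d) * (max 0 (\<sigma> - s) + max 0 (\<tau> - t))"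
    by (simp add: power_slope_def sum.distrib)
  finally show ?thesis .
qed

lemma prob_replicate_pmf_all:
  "measure_pmf.prob (replicate_pmf n p) {xs. \<forall>x \<in> set xs. x \<in> A} = measure_pmf.prob p A ^ n"
proof (induction n)
  case 0
  then show ?case by (simp add: measure_return_pmf)
next
  case (Suc n)
  let ?B = "{xs. \<forall>x \<in> set xs. x \<in> A}"
  have "emeasure (replicate_pmf (Suc n) p) ?B =
     (\<integral>\<^sup>+x. \<integral>\<^sup>+xs. indicator ?B (x # xs) \<partial>replicate_pmf n p \<partial>p)"
    by (simp add: emeasure_return_pmf)
  also have "\<dots> = (\<integral>\<^sup>+x. indicator A x * (\<integral>\<^sup>+xs. indicator ?B xs \<partial>replicate_pmf n p) \<partial>p)"
    by (intro nn_integral_cong) (auto simp: indicator_def)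
  also have "\<dots> = emeasure p A * emeasure (replicate_pmf n p) ?B"
    by (simp add: nn_integral_multc)
  finally have "emeasure (replicate_pmf (Suc n) p) ?B = emeasure p A * emeasure (replicate_pmf n p) ?B" .
  hence "measure_pmf.prob (replicate_pmf (Suc n) p) ?B = measure_pmf.prob p A * measure_pmf.prob (replicate_pmf n p) ?B"
    by (simp add: measure_def enn2real_mult)
  thus ?case using Suc by simp
qed

lemma map_replicate_pmf: "map_pmf (map f) (replicate_pmf n p) = replicate_pmf n (map_pmf f p)"
proof (induction n)
  case (Suc n)
  show ?case by (simp add: map_bind_pmf bind_map_pmf flip: Suc.IH)
qed simp

definition shortest :: "('v \<Rightarrow> nat) \<Rightarrow> 'v list \<Rightarrow> 'v set" where
  "shortest x vs = {v \<in> set vs. \<forall>u \<in> set vs. x v \<le> x u}"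

lemma shortest_nonempty: "vs \<noteq> [] \<Longrightarrow> shortest x vs \<noteq> {}"
proof -
  assume "vs \<noteq> []"
  then obtain v where "v \<in> set vs" "\<forall>u \<in> set vs. x v \<le> x u"
    using ex_min_if_finite[of "x ` set vs"] by (auto simp: not_less)
  thus ?thesis by (auto simp: shortest_def)
qed

lemma finite_shortest: "finite (shortest x vs)" by (simp add: shortest_def)

lemma joined_server_alt:
  "joined_server d G x w =
     bind_pmf (replicate_pmf d (pmf_of_set (type_nbrs G w))) (\<lambda>vs. pmf_of_set (shortest x vs))"
  by (simp add: joined_server_def shortest_def)

text \<open>
  The joined server has the minimal queue length in the sample, so it has length at least \<open>k\<close> exactly
  when all \<open>d\<close> independent samples do.
\<close>

lemma joined_server_tail:
  assumes "d \<ge> 1"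
  shows "measure_pmf.prob (joined_server d G x w) {v. k \<le> x v}
       = measure_pmf.prob (pmf_of_set (type_nbrs G w)) {v. k \<le> x v} ^ d"
proof -
  let ?R = "replicate_pmf d (pmf_of_set (type_nbrs G w))"
  let ?B = "{vs. \<forall>v \<in> set vs. v \<in> {v. k \<le> x v}}"
  have "emeasure (joined_server d G x w) {v. k \<le> x v} =
     (\<integral>\<^sup>+vs. emeasure (pmf_of_set (shortest x vs)) {v. k \<le> x v} \<partial>?R)"
    by (simp add: joined_server_alt)
  also have "\<dots> = (\<integral>\<^sup>+vs. indicator ?B vs \<partial>?R)"
  proof (intro nn_integral_cong_AE, unfold AE_measure_pmf_iff, rule ballI)
    fix vs assume "vs \<in> set_pmf ?R"
    hence ne: "vs \<noteq> []" using assms by (auto simp: set_replicate_pmf)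
    note m = shortest_nonempty[OF ne, of x] finite_shortest[of x vs]
    have "measure_pmf.prob (pmf_of_set (shortest x vs)) {v. k \<le> x v} = indicator ?B vs"
    proof (cases "vs \<in> ?B")
      case True
      hence "shortest x vs \<inter> {v. k \<le> x v} = shortest x vs" by (auto simp: shortest_def)
      thus ?thesis using m True by (simp add: measure_pmf_of_set)
    next
      case False
      then obtain u where "u \<in> set vs" "x u < k" by auto
      hence "shortest x vs \<inter> {v. k \<le> x v} = {}" by (force simp: shortest_def)
      thus ?thesis using m False by (simp add: measure_pmf_of_set)
    qed
    thus "emeasure (pmf_of_set (shortest x vs)) {v. k \<le> x v} = indicator ?B vs"
      by (simp add: measure_pmf.emeasure_eq_measure indicator_def)
  qed
  also have "\<dots> = emeasure ?R ?B" by simp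
  finally have "measure_pmf.prob (joined_server d G x w) {v. k \<le> x v} = measure_pmf.prob ?R ?B"
    by (simp add: measure_def)
  thus ?thesis by (simp only: prob_replicate_pmf_all)
qed

text \<open>
  Swapping two compatible servers of equal queue length preserves the law of the sample and commutes
  with taking the shortest servers.
\<close>

lemma joined_server_exchangeable:
  assumes fin: "finite (type_nbrs G w)" and u: "u \<in> type_nbrs G w" and v: "v \<in> type_nbrs G w"
    and d: "d \<ge> 1" and eq: "x u = x v"
  shows "pmf (joined_server d G x w) u = pmf (joined_server d G x w) v"
proof -
  let ?f = "Transposition.transpose u v"
  let ?R = "replicate_pmf d (pmf_of_set (type_nbrs G w))"
  have x: "x (?f a) = x a" for a using eq by (auto simp: Transposition.transpose_def)
  have ff: "?f (?f a) = a" for a by simp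
  have im: "?f ` type_nbrs G w = type_nbrs G w"
    using u v by simp
  have P: "map_pmf ?f (pmf_of_set (type_nbrs G w)) = pmf_of_set (type_nbrs G w)"
    using fin u im by (subst map_pmf_of_set_inj) auto
  have sh: "shortest x (map ?f vs) = ?f ` shortest x vs" for vs
    unfolding shortest_def by (auto simp: x)
  have "map_pmf ?f (joined_server d G x w) = bind_pmf ?R (\<lambda>vs. map_pmf ?f (pmf_of_set (shortest x vs)))"
    by (simp add: joined_server_alt map_bind_pmf)
  also have "\<dots> = bind_pmf ?R (\<lambda>vs. pmf_of_set (shortest x (map ?f vs)))"
  proof (rule bind_pmf_cong[OF refl])
    fix vs assume "vs \<in> set_pmf ?R"
    hence ne: "vs \<noteq> []" using d by (auto simp: set_replicate_pmf)
    show "map_pmf ?f (pmf_of_set (shortest x vs)) = pmf_of_set (shortest x (map ?f vs))"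
      unfolding sh using shortest_nonempty[OF ne] finite_shortest
      by (intro map_pmf_of_set_inj) (auto intro: inj_on_subset[OF inj_transpose])
  qed
  also have "\<dots> = bind_pmf (map_pmf (map ?f) ?R) (\<lambda>vs. pmf_of_set (shortest x vs))"
    by (simp add: bind_map_pmf)
  also have "\<dots> = joined_server d G x w"
    by (simp add: joined_server_alt map_replicate_pmf P)
  finally have "map_pmf ?f (joined_server d G x w) = joined_server d G x w" .
  hence "pmf (joined_server d G x w) v = pmf (map_pmf ?f (joined_server d G x w)) (?f u)" by simp
  also have "\<dots> = pmf (joined_server d G x w) u"
    by (rule pmf_map_inj') (rule inj_transpose)
  finally show ?thesis by simp
qed

lemma set_pmf_joined_server:
  assumes "finite (type_nbrs G w)" "type_nbrs G w \<noteq> {}" "d \<ge> 1"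
  shows "set_pmf (joined_server d G x w) \<subseteq> type_nbrs G w"
proof -
  have "set_pmf (pmf_of_set (shortest x vs)) \<subseteq> type_nbrs G w"
    if "vs \<in> set_pmf (replicate_pmf d (pmf_of_set (type_nbrs G w)))" for vs
  proof -
    have "set vs \<subseteq> type_nbrs G w" "vs \<noteq> []"
      using that assms by (auto simp: set_replicate_pmf)
    thus ?thesis using shortest_nonempty[of vs x] finite_shortest[of x vs] 
      by (subst set_pmf_of_set) (auto simp: shortest_def)
  qed
  thus ?thesis by (auto simp: joined_server_alt)
qed

section \<open>Local occupancies and the generator of the queue length process\<close>

text \<open>
  Column \<open>w\<close> of this matrix is the uniform distribution on the servers compatible with \<open>w\<close>.
\<close>

definition compat_weight :: "('v, 'w) compat_graph \<Rightarrow> 'v \<Rightarrow> 'w \<Rightarrow> real" where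
  "compat_weight G v w = of_bool ((v, w) \<in> edges G) / real (card (type_nbrs G w))"

text \<open>
  The relative arrival rate at \<open>v\<close> if tasks joined uniformly chosen compatible servers. The maximum
  of its deviation from 1 is \<open>phi\<close>, and \<open>\<lambda>\<close> times its maximum is \<open>rho\<close>.
\<close>

definition server_load :: "('v, 'w) compat_graph \<Rightarrow> 'v \<Rightarrow> real" where
  "server_load G v =
     real (card (servers G)) / real (card (task_types G)) * (\<Sum>w \<in> task_types G. compat_weight G v w)"

definition local_occ :: "('v, 'w) compat_graph \<Rightarrow> 'w \<Rightarrow> nat \<Rightarrow> ('v \<Rightarrow> nat) \<Rightarrow> real" where
  "local_occ G w i x = (\<Sum>v \<in> servers G. compat_weight G v w * of_bool (i \<le> x v))"

definition type_mean :: "('v, 'w) compat_graph \<Rightarrow> ('w \<Rightarrow> real) \<Rightarrow> real" where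
  "type_mean G F = (\<Sum>w \<in> task_types G. F w) / real (card (task_types G))"

text \<open>
  The generator of the queue length process applied to \<open>f\<close>, written as a sum over arrivals and
  departures instead of over target states.
\<close>

definition queue_drift ::
    "real \<Rightarrow> nat \<Rightarrow> ('v, 'w) compat_graph \<Rightarrow> (('v \<Rightarrow> nat) \<Rightarrow> real) \<Rightarrow> ('v \<Rightarrow> nat) \<Rightarrow> real" where
  "queue_drift lam d G f x =
     (\<Sum>w \<in> task_types G. \<Sum>v \<in> servers G.
        lam * real (card (servers G)) / real (card (task_types G)) * pmf (joined_server d G x w) v *
        (f (x(v := x v + 1)) - f x)) +
     (\<Sum>v \<in> servers G. if x v > 0 then f (x(v := x v - 1)) - f x else 0)"

lemma of_bool_eq_level: "of_bool (x v = i) = (of_bool (i \<le> x v) - of_bool (Suc i \<le> x v) :: real)"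
  for x :: "'a \<Rightarrow> nat"
  by auto

locale compat_queues =
  fixes G :: "('v, 'w) compat_graph" and lam :: real and d :: nat
  assumes compat: "compatibility_graph G" and lam_pos: "0 < lam" and lam_less_1: "lam < 1"
    and d_ge_1: "d \<ge> 1"
begin

abbreviation "V \<equiv> servers G"
abbreviation "W \<equiv> task_types G"
abbreviation "nV \<equiv> real (card (servers G))"
abbreviation "nW \<equiv> real (card (task_types G))"

lemma finite_V: "finite V" and finite_W: "finite W" and V_ne: "V \<noteq> {}" and W_ne: "W \<noteq> {}"
  using compat by (auto simp: compatibility_graph_def)

lemma nV_pos: "nV > 0" and nW_pos: "nW > 0"
  using finite_V finite_W V_ne W_ne by (auto simp: card_gt_0_iff)

lemma finite_type_nbrs: "finite (type_nbrs G w)"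
  using finite_V by (simp add: type_nbrs_def)

lemma type_nbrs_nonempty: "w \<in> W \<Longrightarrow> type_nbrs G w \<noteq> {}"
  using compat by (force simp: compatibility_graph_def)

lemma weight_nonneg: "0 \<le> compat_weight G v w"
  by (simp add: compat_weight_def)

lemma sum_weight_type: 
  assumes "w \<in> W"
  shows "(\<Sum>v \<in> V. compat_weight G v w * of_bool (P v)) =
      real (card {v \<in> type_nbrs G w. P v}) / real (card (type_nbrs G w))"
proof -
  have "(\<Sum>v \<in> V. compat_weight G v w * of_bool (P v)) =
     (\<Sum>v \<in> V. of_bool ((v, w) \<in> edges G \<and> P v)) / real (card (type_nbrs G w))"
    unfolding sum_divide_distrib by (intro sum.cong) (auto simp: compat_weight_def)
  also have "(\<Sum>v \<in> V. of_bool ((v, w) \<in> edges G \<and> P v)) = real (card {v \<in> type_nbrs G w. P v})"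
    using finite_V by (auto simp: type_nbrs_def Int_def intro!: arg_cong[where f = card])
  finally show ?thesis .
qed

lemma sum_weight_eq_1: "w \<in> W \<Longrightarrow> (\<Sum>v \<in> V. compat_weight G v w) = 1"
  using sum_weight_type[of w "\<lambda>_. True"] finite_type_nbrs type_nbrs_nonempty by simp

lemma sum_weight_sq: "w \<in> W \<Longrightarrow> (\<Sum>v \<in> V. (compat_weight G v w)\<^sup>2) = 1 / real (card (type_nbrs G w))"
proof -
  assume w: "w \<in> W"
  have "(\<Sum>v \<in> V. (compat_weight G v w)\<^sup>2) = (\<Sum>v \<in> V. compat_weight G v w / real (card (type_nbrs G w)))"
    by (intro sum.cong) (auto simp: compat_weight_def power2_eq_square)
  thus ?thesis using sum_weight_eq_1[OF w] by (simp flip: sum_divide_distrib)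
qed

lemma gamma_eq: "gamma G = type_mean G (\<lambda>w. \<Sum>v \<in> V. (compat_weight G v w)\<^sup>2)"
  by (simp add: gamma_def type_mean_def sum_weight_sq)

lemma server_load_eq:
  "server_load G v = nV / nW * (\<Sum>w \<in> server_nbrs G v. 1 / real (card (type_nbrs G w)))"
proof -
  have "(\<Sum>w \<in> W. compat_weight G v w) = (\<Sum>w \<in> server_nbrs G v. 1 / real (card (type_nbrs G w)))"
    unfolding server_nbrs_def using finite_W
    by (intro sum.mono_neutral_cong_right) (auto simp: compat_weight_def)
  thus ?thesis by (simp add: server_load_def)
qed

lemma server_load_le_rho: "v \<in> V \<Longrightarrow> lam * server_load G v \<le> rho lam G"
  unfolding rho_def server_load_eq using finite_V by (auto intro!: Max_ge)

lemma server_load_phi: "v \<in> V \<Longrightarrow> \<bar>server_load G v - 1\<bar> \<le> phi G"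
  unfolding phi_def server_load_eq using finite_V by (auto intro!: Max_ge)

lemma phi_nonneg: "0 \<le> phi G"
  using server_load_phi V_ne by (meson abs_ge_zero ex_in_conv order_trans)

lemma server_load_nonneg: "0 \<le> server_load G v"
  by (simp add: server_load_def sum_nonneg weight_nonneg)

lemma rho_nonneg: "0 \<le> rho lam G"
proof -
  obtain v where "v \<in> V" using V_ne by auto
  thus ?thesis using server_load_le_rho[of v] server_load_nonneg[of v] lam_pos
    by (meson mult_nonneg_nonneg less_imp_le order_trans)
qed

lemma local_occ_nonneg: "0 \<le> local_occ G w i x"
  by (simp add: local_occ_def sum_nonneg weight_nonneg)

lemma local_occ_le_1: "w \<in> W \<Longrightarrow> local_occ G w i x \<le> 1"
  unfolding local_occ_def sum_weight_eq_1[symmetric]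
  by (intro sum_mono) (simp add: weight_nonneg)

lemma local_occ_0: "w \<in> W \<Longrightarrow> local_occ G w 0 x = 1"
  using sum_weight_eq_1 by (simp add: local_occ_def)

lemma local_occ_level:
  "(\<Sum>v \<in> V. compat_weight G v w * of_bool (x v = i)) = local_occ G w i x - local_occ G w (Suc i) x"
  by (simp add: local_occ_def of_bool_eq_level right_diff_distrib sum_subtractf)

lemma occupancy_level:
  "(\<Sum>v \<in> V. of_bool (x v = i)) / nV = occupancy G i x - occupancy G (Suc i) x"
  by (simp only: occupancy_def of_bool_eq_level sum_subtractf) (simp add: diff_divide_distrib)

lemma occupancy_bounds: "0 \<le> occupancy G i x" "occupancy G i x \<le> 1"
proof -
  show "0 \<le> occupancy G i x" by (simp add: occupancy_def sum_nonneg)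
  have "(\<Sum>v \<in> V. of_bool (x v \<ge> i)) \<le> (\<Sum>v \<in> V. 1 :: real)" by (intro sum_mono) auto
  thus "occupancy G i x \<le> 1" using nV_pos by (simp add: occupancy_def)
qed

lemma occupancy_0: "occupancy G 0 x = 1"
  using nV_pos by (simp add: occupancy_def)

lemma type_mean_add: "type_mean G (\<lambda>w. F w + H w) = type_mean G F + type_mean G H"
  by (simp add: type_mean_def sum.distrib add_divide_distrib)

lemma type_mean_diff: "type_mean G (\<lambda>w. F w - H w) = type_mean G F - type_mean G H"
  by (simp add: type_mean_def sum_subtractf diff_divide_distrib)

lemma type_mean_cmult: "type_mean G (\<lambda>w. c * F w) = c * type_mean G F"
  by (simp add: type_mean_def sum_distrib_left)

lemma type_mean_const: "type_mean G (\<lambda>w. c) = c"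
  using nW_pos by (simp add: type_mean_def)

lemma type_mean_mono: "(\<And>w. w \<in> W \<Longrightarrow> F w \<le> H w) \<Longrightarrow> type_mean G F \<le> type_mean G H"
  by (simp add: type_mean_def divide_right_mono sum_mono)

lemma type_mean_bounded: "(\<And>w. w \<in> W \<Longrightarrow> \<bar>F w\<bar> \<le> B) \<Longrightarrow> \<bar>type_mean G F\<bar> \<le> B"
  using type_mean_mono[of F "\<lambda>_. B"] type_mean_mono[of "\<lambda>_. - B" F] 
  by (force simp: type_mean_const abs_le_iff)

lemma abs_type_mean_le: "\<bar>type_mean G F\<bar> \<le> type_mean G (\<lambda>w. \<bar>F w\<bar>)"
  by (simp add: type_mean_def divide_right_mono)

lemma type_mean_weighted:
  "type_mean G (\<lambda>w. \<Sum>v \<in> V. compat_weight G v w * g v) = (\<Sum>v \<in> V. server_load G v * g v) / nV"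
proof -
  have "type_mean G (\<lambda>w. \<Sum>v \<in> V. compat_weight G v w * g v)
     = (\<Sum>v \<in> V. \<Sum>w \<in> W. compat_weight G v w * g v) / nW"
    unfolding type_mean_def by (subst sum.swap) simp
  also have "\<dots> = (\<Sum>v \<in> V. server_load G v * g v) / nV"
    using nV_pos by (simp add: server_load_def sum_divide_distrib sum_distrib_right)
  finally show ?thesis .
qed

text \<open>
  The left side spreads the errors \<open>e\<close> from each type to the types with which it shares a server.
  The kernel of this operation has column sums at most \<open>1 + phi\<close>, so errors that are small for most
  types stay small on average.
\<close>

lemma type_mean_kernel:
  assumes "\<And>w. w \<in> W \<Longrightarrow> 0 \<le> e w"
  shows "type_mean G (\<lambda>w. \<Sum>v \<in> V. compat_weight G v w * (nV / nW * (\<Sum>w' \<in> W. compat_weight G v w' * e w')))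
      \<le> (1 + phi G) * type_mean G e"
proof -
  let ?k = "\<lambda>v. nV / nW * (\<Sum>w' \<in> W. compat_weight G v w' * e w')"
  have k: "0 \<le> ?k v" for v
    using assms by (intro mult_nonneg_nonneg sum_nonneg) (auto simp: weight_nonneg)
  have "type_mean G (\<lambda>w. \<Sum>v \<in> V. compat_weight G v w * ?k v) = (\<Sum>v \<in> V. server_load G v * ?k v) / nV"
    by (rule type_mean_weighted)
  also have "\<dots> \<le> (\<Sum>v \<in> V. (1 + phi G) * ?k v) / nV"
    using server_load_phi k
    by (intro divide_right_mono sum_mono mult_right_mono) (force simp: abs_le_iff algebra_simps)+
  also have "\<dots> = (1 + phi G) * ((\<Sum>v \<in> V. \<Sum>w' \<in> W. compat_weight G v w' * e w') / nW)"
    using nV_pos by (simp add: sum_distrib_left sum_divide_distrib)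
  also have "(\<Sum>v \<in> V. \<Sum>w' \<in> W. compat_weight G v w' * e w') = (\<Sum>w' \<in> W. (\<Sum>v \<in> V. compat_weight G v w') * e w')"
    by (subst sum.swap) (simp add: sum_distrib_right)
  also have "\<dots> = (\<Sum>w' \<in> W. e w')" by (simp add: sum_weight_eq_1)
  finally show ?thesis by (simp add: type_mean_def)
qed

lemma type_mean_local_occ:
  "type_mean G (\<lambda>w. local_occ G w i x) = (\<Sum>v \<in> V. server_load G v * of_bool (i \<le> x v)) / nV"
  unfolding local_occ_def by (rule type_mean_weighted)

lemma type_mean_local_occ_phi:
  "\<bar>type_mean G (\<lambda>w. local_occ G w i x) - occupancy G i x\<bar> \<le> phi G * occupancy G i x"
proof -
  have "type_mean G (\<lambda>w. local_occ G w i x) - occupancy G i x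
      = (\<Sum>v \<in> V. (server_load G v - 1) * of_bool (i \<le> x v)) / nV"
    by (simp add: type_mean_local_occ occupancy_def left_diff_distrib sum_subtractf diff_divide_distrib)
  also have "\<bar>\<dots>\<bar> \<le> (\<Sum>v \<in> V. phi G * of_bool (i \<le> x v)) / nV"
    unfolding abs_divide using server_load_phi
    by (auto intro!: divide_right_mono order_trans[OF sum_abs] sum_mono simp: abs_mult)
  also have "\<dots> = phi G * occupancy G i x" by (simp add: occupancy_def sum_distrib_left sum_divide_distrib)
  finally show ?thesis .
qed

lemma type_mean_local_occ_rho:
  "lam * type_mean G (\<lambda>w. local_occ G w i x) \<le> rho lam G * occupancy G i x"
proof -
  have "lam * type_mean G (\<lambda>w. local_occ G w i x) = (\<Sum>v \<in> V. lam * server_load G v * of_bool (i \<le> x v)) / nV"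
    by (simp add: type_mean_local_occ sum_distrib_left mult.assoc)
  also have "\<dots> \<le> (\<Sum>v \<in> V. rho lam G * of_bool (i \<le> x v)) / nV"
    using server_load_le_rho by (intro divide_right_mono sum_mono mult_right_mono) auto
  also have "\<dots> = rho lam G * occupancy G i x" by (simp add: occupancy_def sum_distrib_left sum_divide_distrib)
  finally show ?thesis .
qed

text \<open>
  The probability that the joined server has length exactly \<open>k\<close> is a difference of two tails, and by
  exchangeability it is shared equally among the compatible servers of that length.
\<close>

lemma pmf_joined_server:
  assumes w: "w \<in> W" and v: "v \<in> V"
  shows "pmf (joined_server d G x w) v =
    compat_weight G v w * power_slope d (local_occ G w (x v) x) (local_occ G w (Suc (x v)) x)"
proof (cases "v \<in> type_nbrs G w")
  case False
  hence "v \<notin> set_pmf (joined_server d G x w)"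
    using set_pmf_joined_server[OF finite_type_nbrs type_nbrs_nonempty[OF w] d_ge_1] by blast
  moreover have "(v, w) \<notin> edges G" using False v by (simp add: type_nbrs_def)
  ultimately show ?thesis by (simp add: compat_weight_def set_pmf_iff)
next
  case True
  let ?J = "joined_server d G x w" and ?T = "type_nbrs G w"
  let ?k = "x v" and ?q = "\<lambda>i. local_occ G w i x"
  let ?n = "real (card {u \<in> ?T. x u = ?k})" and ?m = "real (card ?T)"
  have m: "?m > 0" using finite_type_nbrs type_nbrs_nonempty[OF w] by (simp add: card_gt_0_iff)
  have n: "?n > 0" using True finite_type_nbrs by (auto simp: card_gt_0_iff)
  have tail: "measure_pmf.prob ?J {u. i \<le> x u} = ?q i ^ d" for i
  proof -
    have "measure_pmf.prob (pmf_of_set ?T) {u. i \<le> x u} = ?q i"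
      using w finite_type_nbrs type_nbrs_nonempty[OF w]
      by (simp add: measure_pmf_of_set local_occ_def sum_weight_type Int_def)
    thus ?thesis by (simp add: joined_server_tail[OF d_ge_1])
  qed
  have "measure_pmf.prob ?J {u. x u = ?k} = measure_pmf.prob ?J ({u. ?k \<le> x u} - {u. Suc ?k \<le> x u})"
    by (rule arg_cong[where f = "measure_pmf.prob ?J"]) auto
  also have "\<dots> = ?q ?k ^ d - ?q (Suc ?k) ^ d"
    by (subst measure_pmf.finite_measure_Diff) (auto simp: tail)
  finally have lev: "measure_pmf.prob ?J {u. x u = ?k} = ?q ?k ^ d - ?q (Suc ?k) ^ d" .
  have "measure_pmf.prob ?J {u. x u = ?k} = measure_pmf.prob ?J {u \<in> ?T. x u = ?k}"
    using set_pmf_joined_server[OF finite_type_nbrs type_nbrs_nonempty[OF w] d_ge_1, of x]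
    by (intro measure_pmf.finite_measure_eq_AE) (auto simp: AE_measure_pmf_iff)
  also have "\<dots> = (\<Sum>u \<in> {u \<in> ?T. x u = ?k}. pmf ?J u)"
    using finite_type_nbrs by (intro measure_measure_pmf_finite) auto
  also have "\<dots> = (\<Sum>u \<in> {u \<in> ?T. x u = ?k}. pmf ?J v)"
    using True finite_type_nbrs d_ge_1 by (intro sum.cong joined_server_exchangeable) auto
  also have "\<dots> = ?n * pmf ?J v" by simp
  finally have "?n * pmf ?J v = (?q ?k - ?q (Suc ?k)) * power_slope d (?q ?k) (?q (Suc ?k))"
    using lev by (simp add: power_slope_mult)
  also have "?q ?k - ?q (Suc ?k) = ?n / ?m"
    using local_occ_level[where i = ?k] sum_weight_type[OF w, of "\<lambda>u. x u = ?k"] by simp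
  finally have "pmf ?J v = power_slope d (?q ?k) (?q (Suc ?k)) / ?m"
    using n m by (simp add: field_simps)
  moreover have "compat_weight G v w = 1 / ?m"
    using True by (simp add: compat_weight_def type_nbrs_def)
  ultimately show ?thesis by simp
qed

lemma pmf_joined_server_le: "w \<in> W \<Longrightarrow> v \<in> V \<Longrightarrow> pmf (joined_server d G x w) v \<le> compat_weight G v w * real d"
  by (simp add: pmf_joined_server weight_nonneg mult_left_mono power_slope_le local_occ_nonneg local_occ_le_1)

text \<open>
  The set \<open>F\<close> consists of all states that are reachable from \<open>x\<close> by one jump. Grouping the jumps by
  their cause rather than by their target state avoids any question of coinciding targets.
\<close>

lemma sum_queue_rate:
  assumes F: "F = (\<lambda>v. x(v := x v + 1)) ` V \<union> (\<lambda>v. x(v := x v - 1)) ` {v \<in> V. x v > 0}"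
  shows "(\<Sum>y \<in> F. queue_rate lam d G x y * g y) =
    (\<Sum>w \<in> W. \<Sum>v \<in> V. lam * nV / nW * pmf (joined_server d G x w) v * g (x(v := x v + 1))) +
    (\<Sum>v \<in> V. if x v > 0 then g (x(v := x v - 1)) else 0)"
proof -
  have fin: "finite F" using F finite_V by auto
  have up: "(\<Sum>y \<in> F. (if y = x(v := x v + 1) then c else 0) * g y) = c * g (x(v := x v + 1))"
    if "v \<in> V" for v c
  proof -
    have "x(v := x v + 1) \<in> F" using that F by auto
    thus ?thesis using fin by (simp add: if_distrib[of "\<lambda>t. t * _"] cong: if_cong)
  qed
  have down: "(\<Sum>y \<in> F. (if x v > 0 \<and> y = x(v := x v - 1) then 1 else 0) * g y) =
     (if x v > 0 then g (x(v := x v - 1)) else 0)" if "v \<in> V" for v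
  proof (cases "x v > 0")
    case True
    hence "x(v := x v - 1) \<in> F" using that F by auto
    thus ?thesis using fin True by (simp add: if_distrib[of "\<lambda>t. t * _"] cong: if_cong)
  qed simp
  let ?u = "\<lambda>y w v. (if y = x(v := x v + 1)
        then lam * nV / nW * pmf (joined_server d G x w) v else 0) * g y"
  let ?d = "\<lambda>y v. (if x v > 0 \<and> y = x(v := x v - 1) then 1 else 0) * g y"
  have "(\<Sum>y \<in> F. queue_rate lam d G x y * g y) =
      (\<Sum>y \<in> F. \<Sum>w \<in> W. \<Sum>v \<in> V. ?u y w v) + (\<Sum>y \<in> F. \<Sum>v \<in> V. ?d y v)"
    by (simp only: queue_rate_def distrib_right sum.distrib sum_distrib_right)
  also have "(\<Sum>y \<in> F. \<Sum>w \<in> W. \<Sum>v \<in> V. ?u y w v) = (\<Sum>w \<in> W. \<Sum>v \<in> V. \<Sum>y \<in> F. ?u y w v)"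
    by (subst sum.swap, intro sum.cong refl, rule sum.swap)
  also have "(\<Sum>y \<in> F. \<Sum>v \<in> V. ?d y v) = (\<Sum>v \<in> V. \<Sum>y \<in> F. ?d y v)"
    by (rule sum.swap)
  finally show ?thesis by (simp only: up down cong: sum.cong)
qed

lemma stationary_queue_drift:
  fixes f :: "('v \<Rightarrow> nat) \<Rightarrow> real"
  assumes st: "stationary_distribution (queue_states G) (queue_rate lam d G) p"
    and B: "\<And>x. \<bar>f x\<bar> \<le> B"
  shows "integrable (measure_pmf p) (queue_drift lam d G f)"
    and "measure_pmf.expectation p (queue_drift lam d G f) = 0"
proof -
  define F where "F x = (\<lambda>v. x(v := x v + 1)) ` V \<union> (\<lambda>v. x(v := x v - 1)) ` {v \<in> V. x v > 0}"
    for x :: "'v \<Rightarrow> nat"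
  have upd: "x(v := k) \<in> queue_states G" if "x \<in> queue_states G" "v \<in> V" for x v k
    using that unfolding queue_states_def
    by (metis PiE_fun_upd insert_absorb UNIV_I)
  have neq: "x(v := x v + 1) \<noteq> x" "x v > 0 \<Longrightarrow> x(v := x v - 1) \<noteq> x" for x :: "'v \<Rightarrow> nat" and v
    by (auto simp: fun_eq_iff)
  have 1: "finite (F x) \<and> F x \<subseteq> queue_states G - {x} \<and>
       (\<forall>y\<in>queue_states G - {x} - F x. queue_rate lam d G x y = 0)"
    and 2: "(\<Sum>y \<in> F x. queue_rate lam d G x y) \<le> lam * nV + nV" if x: "x \<in> queue_states G" for x
  proof -
    have "queue_rate lam d G x y = 0" if "y \<notin> F x" for y
    proof -
      have "y \<noteq> x(v := x v + 1)" "\<not> (x v > 0 \<and> y = x(v := x v - 1))" if "v \<in> V" for v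
        using \<open>y \<notin> F x\<close> that by (auto simp: F_def)
      thus ?thesis unfolding queue_rate_def by (simp add: sum.neutral)
    qed
    moreover have "finite (F x)" using finite_V by (simp add: F_def)
    moreover have "F x \<subseteq> queue_states G - {x}"
    proof
      fix y assume "y \<in> F x"
      then obtain v where "v \<in> V" "y = x(v := x v + 1) \<or> x v > 0 \<and> y = x(v := x v - 1)"
        unfolding F_def by blast
      thus "y \<in> queue_states G - {x}" using neq[of x v] upd[OF x, of v] by auto
    qed
    ultimately show "finite (F x) \<and> F x \<subseteq> queue_states G - {x} \<and>
       (\<forall>y\<in>queue_states G - {x} - F x. queue_rate lam d G x y = 0)" by blast
    have "(\<Sum>y \<in> F x. queue_rate lam d G x y) = 
       (\<Sum>w \<in> W. \<Sum>v \<in> V. lam * nV / nW * pmf (joined_server d G x w) v) + (\<Sum>v \<in> V. if x v > 0 then 1 else 0)"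
      using sum_queue_rate[OF F_def, of x "\<lambda>_. 1"] by simp
    also have "(\<Sum>w \<in> W. \<Sum>v \<in> V. lam * nV / nW * pmf (joined_server d G x w) v) \<le> (\<Sum>w \<in> W. lam * nV / nW * 1)"
      unfolding sum_distrib_left[symmetric] using lam_pos finite_V
      by (intro sum_mono mult_left_mono)
         (simp_all add: measure_measure_pmf_finite[symmetric])
    also have "\<dots> = lam * nV" using nW_pos by simp
    also have "(\<Sum>v \<in> V. if x v > 0 then 1 else 0) \<le> (\<Sum>v \<in> V. 1 :: real)" by (intro sum_mono) auto
    finally show "(\<Sum>y \<in> F x. queue_rate lam d G x y) \<le> lam * nV + nV" by simp
  qed
  have "(\<lambda>x. \<Sum>y \<in> F x. queue_rate lam d G x y * (f y - f x)) = queue_drift lam d G f"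
    by (intro ext) (simp add: sum_queue_rate[OF F_def] queue_drift_def)
  with stationary_expectation_generator_eq_0[where f = f, OF st 1 2 B]
  show "integrable (measure_pmf p) (queue_drift lam d G f)"
    and "measure_pmf.expectation p (queue_drift lam d G f) = 0"
    by simp_all
qed

end

section \<open>Drift of the occupancies and of the squared shortfall\<close>

text \<open>
  The derivative \<open>- 2 max 0 (b - u)\<close> of \<open>u \<mapsto> (max 0 (b - u))^2\<close> is Lipschitz with constant 2, which
  bounds the increment by a second-order Taylor polynomial.
\<close>

lemma sq_shortfall_step:
  fixes b u \<delta> :: real
  shows "(max 0 (b - (u + \<delta>)))\<^sup>2 - (max 0 (b - u))\<^sup>2 \<le> - 2 * max 0 (b - u) * \<delta> + \<delta>\<^sup>2"
proof (cases "u \<le> b")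
  case True
  have "(max 0 (b - (u + \<delta>)))\<^sup>2 \<le> (b - (u + \<delta>))\<^sup>2"
    by (auto simp: max_def)
  also have "\<dots> = (b - u)\<^sup>2 - 2 * (b - u) * \<delta> + \<delta>\<^sup>2"
    by (simp add: power2_eq_square algebra_simps)
  finally have "(max 0 (b - (u + \<delta>)))\<^sup>2 \<le> (b - u)\<^sup>2 - 2 * (b - u) * \<delta> + \<delta>\<^sup>2" .
  moreover have "max 0 (b - u) = b - u" using True by simp
  ultimately show ?thesis by (simp add: algebra_simps)
next
  case False
  have "(max 0 (b - (u + \<delta>)))\<^sup>2 \<le> \<delta>\<^sup>2"
    using False by (intro abs_le_square_iff[THEN iffD1]) (auto simp: max_def)
  thus ?thesis using False by (simp add: max_def)
qed

context compat_queues
begin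

lemma local_occ_up:
  assumes "v \<in> V"
  shows "local_occ G w (Suc i) (x(v := x v + 1)) = 
     local_occ G w (Suc i) x + compat_weight G v w * of_bool (x v = i)"
proof -
  have "local_occ G w (Suc i) (x(v := x v + 1)) = (\<Sum>u \<in> V. compat_weight G u w * of_bool (Suc i \<le> x u) 
     + (if u = v then compat_weight G v w * of_bool (x v = i) else 0))"
    unfolding local_occ_def by (intro sum.cong) auto
  thus ?thesis using assms finite_V by (simp add: sum.distrib local_occ_def)
qed

lemma local_occ_down:
  assumes "v \<in> V" "x v > 0"
  shows "local_occ G w (Suc i) (x(v := x v - 1)) = 
     local_occ G w (Suc i) x - compat_weight G v w * of_bool (x v = Suc i)"
proof -
  have "local_occ G w (Suc i) (x(v := x v - 1)) = (\<Sum>u \<in> V. compat_weight G u w * of_bool (Suc i \<le> x u) 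
     - (if u = v then compat_weight G v w * of_bool (x v = Suc i) else 0))"
    unfolding local_occ_def using assms(2) by (intro sum.cong) auto
  thus ?thesis using assms finite_V by (simp add: sum_subtractf local_occ_def)
qed

lemma occupancy_up:
  assumes "v \<in> V"
  shows "occupancy G (Suc i) (x(v := x v + 1)) - occupancy G (Suc i) x = of_bool (x v = i) / nV"
proof -
  have "(\<Sum>u \<in> V. of_bool (Suc i \<le> (x(v := x v + 1)) u) :: real) = (\<Sum>u \<in> V. of_bool (Suc i \<le> x u) 
     + (if u = v then of_bool (x v = i) else 0))"
    by (intro sum.cong) auto
  thus ?thesis using assms finite_V by (simp add: sum.distrib occupancy_def add_divide_distrib)
qed

lemma occupancy_down:
  assumes "v \<in> V" "x v > 0"
  shows "occupancy G (Suc i) (x(v := x v - 1)) - occupancy G (Suc i) x = - of_bool (x v = Suc i) / nV"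
proof -
  have "(\<Sum>u \<in> V. of_bool (Suc i \<le> (x(v := x v - 1)) u) :: real) = (\<Sum>u \<in> V. of_bool (Suc i \<le> x u) 
     - (if u = v then of_bool (x v = Suc i) else 0))"
    using assms(2) by (intro sum.cong) auto
  thus ?thesis using assms finite_V by (simp add: sum_subtractf occupancy_def diff_divide_distrib)
qed

lemma sum_pmf_joined_level:
  assumes "w \<in> W"
  shows "(\<Sum>v \<in> V. pmf (joined_server d G x w) v * of_bool (x v = i))
    = local_occ G w i x ^ d - local_occ G w (Suc i) x ^ d"
proof -
  have "(\<Sum>v \<in> V. pmf (joined_server d G x w) v * of_bool (x v = i)) =
     (\<Sum>v \<in> V. compat_weight G v w * of_bool (x v = i) * power_slope d (local_occ G w i x) (local_occ G w (Suc i) x))"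
    using assms by (intro sum.cong refl) (auto simp: pmf_joined_server)
  thus ?thesis by (simp only: sum_distrib_right[symmetric] local_occ_level power_slope_mult)
qed

lemma queue_drift_occupancy:
  "queue_drift lam d G (occupancy G (Suc i)) x =
     lam * (type_mean G (\<lambda>w. local_occ G w i x ^ d) - type_mean G (\<lambda>w. local_occ G w (Suc i) x ^ d))
     - (occupancy G (Suc i) x - occupancy G (Suc (Suc i)) x)"
proof -
  have "(\<Sum>w \<in> W. \<Sum>v \<in> V. lam * nV / nW * pmf (joined_server d G x w) v *
        (occupancy G (Suc i) (x(v := x v + 1)) - occupancy G (Suc i) x)) =
      (\<Sum>w \<in> W. lam / nW * (\<Sum>v \<in> V. pmf (joined_server d G x w) v * of_bool (x v = i)))"
    unfolding sum_distrib_left using nV_pos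
    by (intro sum.cong refl) (simp only: occupancy_up, simp)
  also have "\<dots> = lam * type_mean G (\<lambda>w. local_occ G w i x ^ d - local_occ G w (Suc i) x ^ d)"
    by (simp add: sum_pmf_joined_level type_mean_def sum_distrib_left sum_divide_distrib)
  finally have up: "(\<Sum>w \<in> W. \<Sum>v \<in> V. lam * nV / nW * pmf (joined_server d G x w) v *
        (occupancy G (Suc i) (x(v := x v + 1)) - occupancy G (Suc i) x)) =
        lam * type_mean G (\<lambda>w. local_occ G w i x ^ d - local_occ G w (Suc i) x ^ d)" .
  have "(\<Sum>v \<in> V. if x v > 0 then occupancy G (Suc i) (x(v := x v - 1)) - occupancy G (Suc i) x else 0)
     = (\<Sum>v \<in> V. - (of_bool (x v = Suc i) / nV))"
    by (intro sum.cong refl) (auto simp: occupancy_down simp del: One_nat_def)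
  also have "\<dots> = - ((\<Sum>v \<in> V. of_bool (x v = Suc i)) / nV)"
    by (simp only: sum_negf sum_divide_distrib)
  also have "\<dots> = - (occupancy G (Suc i) x - occupancy G (Suc (Suc i)) x)"
    by (simp only: occupancy_level)
  finally show ?thesis unfolding queue_drift_def up by (simp add: type_mean_diff)
qed

definition arrival_rate :: "('v \<Rightarrow> nat) \<Rightarrow> 'v \<Rightarrow> real" where
  "arrival_rate x v = lam * (nV / nW * (\<Sum>w \<in> W. pmf (joined_server d G x w) v))"

lemma queue_drift_eq:
  "queue_drift lam d G f x =
     (\<Sum>v \<in> V. arrival_rate x v * (f (x(v := x v + 1)) - f x) +
       (if x v > 0 then f (x(v := x v - 1)) - f x else 0))"
  unfolding queue_drift_def arrival_rate_def sum.distrib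
  by (subst sum.swap) (simp add: sum_distrib_left sum_distrib_right sum_divide_distrib mult.assoc)

lemma arrival_rate_nonneg: "0 \<le> arrival_rate x v"
  using lam_pos by (simp add: arrival_rate_def sum_nonneg)

lemma arrival_rate_le:
  assumes "v \<in> V"
  shows "arrival_rate x v \<le> real d * (1 + phi G)"
proof -
  have "nV / nW * (\<Sum>w \<in> W. pmf (joined_server d G x w) v) \<le> nV / nW * (\<Sum>w \<in> W. compat_weight G v w * real d)"
    using assms by (intro mult_left_mono sum_mono) (auto simp: pmf_joined_server_le)
  also have "\<dots> = real d * server_load G v"
    by (simp add: server_load_def sum_distrib_right[symmetric])
  also have "\<dots> \<le> real d * (1 + phi G)"
    using server_load_phi[OF assms] by (intro mult_left_mono) auto
  finally have "arrival_rate x v \<le> lam * (real d * (1 + phi G))"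
    unfolding arrival_rate_def using lam_pos by (intro mult_left_mono) auto
  also have "\<dots> \<le> 1 * (real d * (1 + phi G))"
    using lam_less_1 phi_nonneg by (intro mult_right_mono) auto
  finally show ?thesis by simp
qed

text \<open>
  If the local occupancies were exactly \<open>s\<close> and \<open>t\<close> and the load were exactly 1, the arrival rate would
  be \<open>\<lambda>\<close> times the slope at \<open>s\<close> and \<open>t\<close>. By monotonicity only shortfalls below \<open>s\<close> and \<open>t\<close> at
  the types compatible with \<open>v\<close> and the defect of the load reduce it.
\<close>

lemma arrival_rate_ge:
  assumes v: "v \<in> V" and s: "0 \<le> s" "s \<le> 1" and t: "0 \<le> t" "t \<le> 1"
  shows "lam * power_slope d s t - real d * phi G - real (d * d) * 
      (nV / nW * (\<Sum>w \<in> W. compat_weight G v w *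
        (max 0 (s - local_occ G w (x v) x) + max 0 (t - local_occ G w (Suc (x v)) x))))
      \<le> arrival_rate x v"
proof -
  let ?e = "\<lambda>w. max 0 (s - local_occ G w (x v) x) + max 0 (t - local_occ G w (Suc (x v)) x)"
  let ?h = "power_slope d s t"
  let ?K = "nV / nW * (\<Sum>w \<in> W. compat_weight G v w * ?e w)"
  have K: "0 \<le> ?K" by (intro mult_nonneg_nonneg sum_nonneg weight_nonneg) auto
  have h: "0 \<le> ?h" "?h \<le> real d"
    using s t by (auto intro: power_slope_nonneg power_slope_le)
  have "?h * server_load G v - real (d * d) * ?K
      = nV / nW * (\<Sum>w \<in> W. compat_weight G v w * (?h - real (d * d) * ?e w))"
    by (simp add: server_load_def right_diff_distrib sum_subtractf sum_distrib_left
      sum_divide_distrib mult_ac)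
  also have "\<dots> \<le> nV / nW * (\<Sum>w \<in> W. pmf (joined_server d G x w) v)"
  proof (intro mult_left_mono sum_mono)
    fix w assume w: "w \<in> W"
    have "?h - real (d * d) * ?e w \<le> power_slope d (local_occ G w (x v) x) (local_occ G w (Suc (x v)) x)"
      using power_slope_shortfall[of "local_occ G w (x v) x" "local_occ G w (Suc (x v)) x" s t d]
        s t local_occ_nonneg local_occ_le_1[OF w] by simp
    thus "compat_weight G v w * (?h - real (d * d) * ?e w) \<le> pmf (joined_server d G x w) v"
      unfolding pmf_joined_server[OF w v] by (intro mult_left_mono weight_nonneg)
  qed simp
  finally have "lam * (?h * server_load G v - real (d * d) * ?K) \<le> arrival_rate x v"
    unfolding arrival_rate_def using lam_pos by (intro mult_left_mono) auto
  moreover have "lam * (real (d * d) * ?K) \<le> 1 * (real (d * d) * ?K)"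
    using lam_less_1 K by (intro mult_right_mono mult_nonneg_nonneg[of "real (d * d)"]) auto
  moreover have "lam * ?h - real d * phi G \<le> lam * (?h * server_load G v)"
  proof -
    have "lam * ?h * (1 - server_load G v) \<le> lam * ?h * phi G"
      using server_load_phi[OF v] lam_pos h by (intro mult_left_mono) auto
    also have "\<dots> \<le> real d * phi G"
      using h lam_pos lam_less_1 phi_nonneg mult_mono[of lam 1 ?h "real d"] by (intro mult_right_mono) auto
    finally show ?thesis by (simp add: algebra_simps)
  qed
  ultimately show ?thesis by (simp add: right_diff_distrib)
qed

text \<open>
  Linearising at the lower levels \<open>s\<close>, \<open>t\<close>, \<open>u\<close> for the occupancies of levels \<open>i\<close>, \<open>i + 1\<close> and
  \<open>i + 2\<close>, the drift of \<open>q_(i+1)^w\<close> is at least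
  \<open>\<lambda> h s + u - (1 + \<lambda> h) q_(i+1)^w = (1 + \<lambda> h) (b - q_(i+1)^w)\<close> up to shortfalls, where \<open>h\<close> is the
  slope at \<open>s\<close> and \<open>t\<close>. So \<open>b\<close> is the zero of the linearised drift, and \<open>q_(i+1)^w\<close> is pushed up
  whenever it is below \<open>b\<close>; this produces the negative quadratic term. The term with \<open>gamma\<close> is the
  noise: a jump changes \<open>q_(i+1)^w\<close> by one over the degree of \<open>w\<close>, and the rate of such jumps is of the
  order of that degree.
\<close>

lemma queue_drift_sq_shortfall:
  fixes s t u b
  assumes s: "0 \<le> s" "s \<le> 1" and t: "0 \<le> t" "t \<le> 1" and u: "0 \<le> u" "u \<le> 1"
    and b: "(1 + lam * power_slope d s t) * b = lam * power_slope d s t * s + u"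
  defines "\<epsilon> \<equiv> \<lambda>a j x w. max 0 (a - local_occ G w j x)"
  shows "queue_drift lam d G (\<lambda>x. type_mean G (\<lambda>w. (\<epsilon> b (Suc i) x w)\<^sup>2)) x \<le>
     - 2 * type_mean G (\<lambda>w. (\<epsilon> b (Suc i) x w)\<^sup>2)
     + 2 * (real d * type_mean G (\<epsilon> s i x) + type_mean G (\<epsilon> u (Suc (Suc i)) x) + real d * phi G
         + real (d * d) * (1 + phi G) * (type_mean G (\<epsilon> s i x) + type_mean G (\<epsilon> t (Suc i) x)))
     + (real d * (1 + phi G) + 1) * gamma G"
proof -
  let ?h = "power_slope d s t"
  let ?A = "arrival_rate x"
  let ?a = "compat_weight G"
  let ?q = "\<lambda>j w. local_occ G w j x"
  \<comment> \<open>Per type: shortfall \<open>m\<close>, drift \<open>D\<close> and quadratic variation \<open>R\<close> of the local occupancy; \<open>err\<close> collects what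
    separates \<open>D\<close> from the linearised drift.\<close>
  define m where "m w = \<epsilon> b (Suc i) x w" for w
  define e where "e w = \<epsilon> s i x w + \<epsilon> t (Suc i) x w" for w
  define K where "K v = nV / nW * (\<Sum>w \<in> W. ?a v w * e w)" for v
  define D where "D w = (\<Sum>v \<in> V. ?a v w * (?A v * of_bool (x v = i) - of_bool (x v = Suc i)))" for w
  define R where "R w = (\<Sum>v \<in> V. (?a v w)\<^sup>2 * (?A v + 1))" for w
  define err where "err w = real d * \<epsilon> s i x w + \<epsilon> u (Suc (Suc i)) x w + real d * phi G
      + real (d * d) * (\<Sum>v \<in> V. ?a v w * K v)" for w
  have h: "0 \<le> ?h" "?h \<le> real d"
    using s t by (auto intro: power_slope_nonneg power_slope_le)
  have lh: "0 \<le> lam * ?h" "lam * ?h \<le> real d"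
    using h lam_pos lam_less_1 mult_mono[of lam 1 ?h "real d"] by auto
  have e0: "0 \<le> \<epsilon> a j y w" for a j y w by (simp add: \<epsilon>_def)
  have K0: "0 \<le> K v" for v
    unfolding K_def e_def using e0 by (intro mult_nonneg_nonneg sum_nonneg weight_nonneg) auto
  have b1: "b \<le> 1"
  proof -
    have "lam * ?h * s \<le> lam * ?h * 1" using s lh by (intro mult_left_mono) auto
    hence "(1 + lam * ?h) * b \<le> (1 + lam * ?h) * 1" using b u by simp
    thus ?thesis using lh by simp
  qed
  have m01: "0 \<le> m w" "m w \<le> 1" for w
    using b1 local_occ_nonneg[of w "Suc i" x] by (auto simp: m_def \<epsilon>_def)
  have step: "?A v * ((\<epsilon> b (Suc i) (x(v := x v + 1)) w)\<^sup>2 - (m w)\<^sup>2) +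
      (if x v > 0 then (\<epsilon> b (Suc i) (x(v := x v - 1)) w)\<^sup>2 - (m w)\<^sup>2 else 0)
      \<le> - 2 * m w * (?a v w * (?A v * of_bool (x v = i) - of_bool (x v = Suc i)))
         + (?a v w)\<^sup>2 * (?A v + 1)" if v: "v \<in> V" for v w
  proof -
    have "(\<epsilon> b (Suc i) (x(v := x v + 1)) w)\<^sup>2 - (m w)\<^sup>2 \<le>
       - 2 * m w * (?a v w * of_bool (x v = i)) + (?a v w * of_bool (x v = i))\<^sup>2"
      unfolding m_def \<epsilon>_def local_occ_up[where x = x, OF v] by (rule sq_shortfall_step)
    also have "\<dots> \<le> - 2 * m w * (?a v w * of_bool (x v = i)) + (?a v w)\<^sup>2"
      by simp
    finally have 1: "?A v * ((\<epsilon> b (Suc i) (x(v := x v + 1)) w)\<^sup>2 - (m w)\<^sup>2) \<le>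
       ?A v * (- 2 * m w * (?a v w * of_bool (x v = i)) + (?a v w)\<^sup>2)"
      by (intro mult_left_mono arrival_rate_nonneg)
    have 2: "(if x v > 0 then (\<epsilon> b (Suc i) (x(v := x v - 1)) w)\<^sup>2 - (m w)\<^sup>2 else 0)
       \<le> 2 * m w * (?a v w * of_bool (x v = Suc i)) + (?a v w)\<^sup>2"
    proof (cases "x v > 0")
      case True
      have "(\<epsilon> b (Suc i) (x(v := x v - 1)) w)\<^sup>2 - (m w)\<^sup>2 \<le>
        - 2 * m w * (- (?a v w * of_bool (x v = Suc i))) + (- (?a v w * of_bool (x v = Suc i)))\<^sup>2"
        unfolding m_def \<epsilon>_def local_occ_down[where x = x, OF v True] diff_conv_add_uminus[of "local_occ _ _ _ _"]
        by (rule sq_shortfall_step)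
      also have "\<dots> \<le> 2 * m w * (?a v w * of_bool (x v = Suc i)) + (?a v w)\<^sup>2"
        by simp
      finally show ?thesis using True by simp
    next
      case False
      thus ?thesis using m01 weight_nonneg by simp
    qed
    from add_mono[OF 1 2] show ?thesis by (simp add: algebra_simps)
  qed
  have "queue_drift lam d G (\<lambda>x. type_mean G (\<lambda>w. (\<epsilon> b (Suc i) x w)\<^sup>2)) x =
    type_mean G (\<lambda>w. \<Sum>v \<in> V. ?A v * ((\<epsilon> b (Suc i) (x(v := x v + 1)) w)\<^sup>2 - (m w)\<^sup>2) +
      (if x v > 0 then (\<epsilon> b (Suc i) (x(v := x v - 1)) w)\<^sup>2 - (m w)\<^sup>2 else 0))"
  proof -
    have "(\<Sum>v \<in> V. type_mean G (\<lambda>w. H v w)) = type_mean G (\<lambda>w. \<Sum>v \<in> V. H v w)" for H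
      unfolding type_mean_def by (simp add: sum.swap[of _ V W] flip: sum_divide_distrib)
    moreover have "?A v * (type_mean G (\<lambda>w. (\<epsilon> b (Suc i) (x(v := x v + 1)) w)\<^sup>2) - type_mean G (\<lambda>w. (m w)\<^sup>2)) +
      (if x v > 0 then type_mean G (\<lambda>w. (\<epsilon> b (Suc i) (x(v := x v - 1)) w)\<^sup>2) - type_mean G (\<lambda>w. (m w)\<^sup>2) else 0)
      = type_mean G (\<lambda>w. ?A v * ((\<epsilon> b (Suc i) (x(v := x v + 1)) w)\<^sup>2 - (m w)\<^sup>2) +
      (if x v > 0 then (\<epsilon> b (Suc i) (x(v := x v - 1)) w)\<^sup>2 - (m w)\<^sup>2 else 0))" for v
      by (cases "x v > 0") (simp_all only: if_True if_False simp_thms type_mean_add type_mean_diff type_mean_cmult type_mean_const)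
    ultimately show ?thesis unfolding queue_drift_eq by (simp only: m_def)
  qed
  also have "\<dots> \<le> type_mean G (\<lambda>w. - 2 * m w * D w + R w)"
    unfolding D_def R_def sum_distrib_left sum.distrib[symmetric]
    by (intro type_mean_mono sum_mono step)
  also have "\<dots> \<le> type_mean G (\<lambda>w. - 2 * (m w)\<^sup>2 + 2 * err w + (real d * (1 + phi G) + 1) * (\<Sum>v \<in> V. (?a v w)\<^sup>2))"
  proof (rule type_mean_mono)
    fix w assume w: "w \<in> W"
    have "R w \<le> (\<Sum>v \<in> V. (?a v w)\<^sup>2 * (real d * (1 + phi G) + 1))"
      unfolding R_def by (intro sum_mono mult_left_mono add_mono arrival_rate_le) auto
    hence R: "R w \<le> (real d * (1 + phi G) + 1) * (\<Sum>v \<in> V. (?a v w)\<^sup>2)"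
      by (simp add: sum_distrib_right[symmetric] mult.commute)
    have "lam * ?h * (?q i w - ?q (Suc i) w) - (?q (Suc i) w - ?q (Suc (Suc i)) w)
        - real d * phi G - real (d * d) * (\<Sum>v \<in> V. ?a v w * K v)
      = (\<Sum>v \<in> V. ?a v w * (lam * ?h * of_bool (x v = i) - of_bool (x v = Suc i)
           - real d * phi G - real (d * d) * K v))"
    proof -
      have "(\<Sum>v \<in> V. ?a v w * (lam * ?h * of_bool (x v = i) - of_bool (x v = Suc i)
           - real d * phi G - real (d * d) * K v)) =
        lam * ?h * (\<Sum>v \<in> V. ?a v w * of_bool (x v = i)) - (\<Sum>v \<in> V. ?a v w * of_bool (x v = Suc i))
        - real d * phi G * (\<Sum>v \<in> V. ?a v w) - real (d * d) * (\<Sum>v \<in> V. ?a v w * K v)"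
        unfolding sum_distrib_left sum_subtractf[symmetric]
        by (intro sum.cong refl) (simp only: right_diff_distrib mult_ac)
      thus ?thesis by (simp only: local_occ_level sum_weight_eq_1[OF w] mult_1_right)
    qed
    also have "\<dots> \<le> D w"
      unfolding D_def
    proof (intro sum_mono mult_left_mono weight_nonneg)
      fix v assume v: "v \<in> V"
      show "lam * ?h * of_bool (x v = i) - of_bool (x v = Suc i)
           - real d * phi G - real (d * d) * K v \<le> ?A v * of_bool (x v = i) - of_bool (x v = Suc i)"
      proof (cases "x v = i")
        case True
        thus ?thesis using arrival_rate_ge[OF v s t, of x] by (simp add: K_def e_def \<epsilon>_def)
      next
        case False
        have "0 \<le> real d * phi G" "0 \<le> real (d * d) * K v" using K0 phi_nonneg by auto
        thus ?thesis using False by simp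
      qed
    qed
    finally have D1: "lam * ?h * (?q i w - ?q (Suc i) w) - (?q (Suc i) w - ?q (Suc (Suc i)) w)
        - real d * phi G - real (d * d) * (\<Sum>v \<in> V. ?a v w * K v) \<le> D w" .
    have "lam * ?h * (s - ?q i w) \<le> real d * \<epsilon> s i x w"
    proof -
      have "lam * ?h * (s - ?q i w) \<le> lam * ?h * \<epsilon> s i x w"
        using lh by (intro mult_left_mono) (auto simp: \<epsilon>_def)
      also have "\<dots> \<le> real d * \<epsilon> s i x w" using lh e0 by (intro mult_right_mono) auto
      finally show ?thesis .
    qed
    moreover have "u - ?q (Suc (Suc i)) w \<le> \<epsilon> u (Suc (Suc i)) x w" by (simp add: \<epsilon>_def)
    moreover have "(1 + lam * ?h) * (b - ?q (Suc i) w) =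
        lam * ?h * (?q i w - ?q (Suc i) w) - (?q (Suc i) w - ?q (Suc (Suc i)) w)
        + lam * ?h * (s - ?q i w) + (u - ?q (Suc (Suc i)) w)"
      unfolding right_diff_distrib[of "1 + lam * ?h"] b by (simp add: algebra_simps)
    ultimately have D2: "(1 + lam * ?h) * (b - ?q (Suc i) w) - err w \<le> D w"
      using D1 unfolding err_def by linarith
    have err0: "0 \<le> err w"
      unfolding err_def using e0 K0 phi_nonneg
      by (intro add_nonneg_nonneg mult_nonneg_nonneg sum_nonneg weight_nonneg) auto
    \<comment> \<open>Here \<open>m\<close> vanishes unless the local occupancy is below \<open>b\<close>, so its product with \<open>b - q\<close> is its square.\<close>
    have "(m w)\<^sup>2 - err w \<le> m w * D w"
    proof -
      have "(m w)\<^sup>2 \<le> (1 + lam * ?h) * (m w)\<^sup>2"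
        using lh by (simp add: distrib_right)
      also have "(m w)\<^sup>2 = m w * (b - ?q (Suc i) w)"
        by (auto simp: m_def \<epsilon>_def power2_eq_square max_def)
      also have "(1 + lam * ?h) * (m w * (b - ?q (Suc i) w)) = m w * ((1 + lam * ?h) * (b - ?q (Suc i) w))"
        by (simp only: mult_ac)
      finally have "(m w)\<^sup>2 \<le> m w * ((1 + lam * ?h) * (b - ?q (Suc i) w))"
        by (auto simp: m_def \<epsilon>_def power2_eq_square max_def)
      moreover have "m w * ((1 + lam * ?h) * (b - ?q (Suc i) w) - err w) \<le> m w * D w"
        by (rule mult_left_mono[OF D2 m01(1)])
      moreover have "m w * err w \<le> 1 * err w" using m01 err0 by (intro mult_right_mono)
      ultimately show ?thesis by (simp add: right_diff_distrib)
    qed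
    thus "- 2 * m w * D w + R w \<le> - 2 * (m w)\<^sup>2 + 2 * err w + (real d * (1 + phi G) + 1) * (\<Sum>v \<in> V. (?a v w)\<^sup>2)"
      using R by simp
  qed
  also have "\<dots> = - 2 * type_mean G (\<lambda>w. (m w)\<^sup>2) + 2 * type_mean G err + (real d * (1 + phi G) + 1) * gamma G"
    unfolding gamma_eq by (simp only: type_mean_add type_mean_cmult)
  also have "type_mean G err = real d * type_mean G (\<epsilon> s i x) + type_mean G (\<epsilon> u (Suc (Suc i)) x) + real d * phi G
     + real (d * d) * type_mean G (\<lambda>w. \<Sum>v \<in> V. ?a v w * K v)"
    unfolding err_def by (simp only: type_mean_add type_mean_cmult type_mean_const)
  also have "type_mean G (\<lambda>w. \<Sum>v \<in> V. ?a v w * K v) \<le> (1 + phi G) * type_mean G e"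
    unfolding K_def by (rule type_mean_kernel) (simp add: e_def e0)
  also have "type_mean G e = type_mean G (\<epsilon> s i x) + type_mean G (\<epsilon> t (Suc i) x)"
    unfolding e_def by (rule type_mean_add)
  finally show ?thesis by (simp add: m_def mult.assoc mult_left_mono)
qed

end

section \<open>Stationary expectations for one graph\<close>

definition mean_occ :: "('v, 'w) compat_graph \<Rightarrow> ('v \<Rightarrow> nat) pmf \<Rightarrow> nat \<Rightarrow> real" where
  "mean_occ G p i = measure_pmf.expectation p (occupancy G i)"

text \<open>
  The expected amount by which the local occupancy of a uniformly chosen task type falls below \<open>a\<close>.
  It vanishes in the limit precisely when \<open>a\<close> is an asymptotic lower bound for typical local occupancies.
\<close>

definition mean_shortfall ::
    "('v, 'w) compat_graph \<Rightarrow> ('v \<Rightarrow> nat) pmf \<Rightarrow> nat \<Rightarrow> real \<Rightarrow> real" where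
  "mean_shortfall G p i a =
     measure_pmf.expectation p (\<lambda>x. type_mean G (\<lambda>w. max 0 (a - local_occ G w i x)))"

locale stationary_queues = compat_queues G lam d
  for G :: "('v, 'w) compat_graph" and lam d +
  fixes p :: "('v \<Rightarrow> nat) pmf"
  assumes stationary: "stationary_distribution (queue_states G) (queue_rate lam d G) p"
begin

abbreviation "E \<equiv> measure_pmf.expectation p"

lemma integrable_occupancy: "integrable (measure_pmf p) (occupancy G i)"
  using occupancy_bounds by (intro integrable_pmf_bounded[where B = 1]) auto

lemma integrable_type_mean:
  "(\<And>w x. w \<in> W \<Longrightarrow> \<bar>F x w\<bar> \<le> B) \<Longrightarrow> integrable (measure_pmf p) (\<lambda>x. type_mean G (F x))"
  by (intro integrable_pmf_bounded[where B = B] type_mean_bounded)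

lemma local_occ_power_le: "w \<in> W \<Longrightarrow> \<bar>local_occ G w i x ^ n\<bar> \<le> 1"
  by (simp add: local_occ_nonneg local_occ_le_1 power_le_one)

lemma shortfall_bounds: 
  "w \<in> W \<Longrightarrow> a \<le> 1 \<Longrightarrow> \<bar>max 0 (a - local_occ G w i x)\<bar> \<le> 1"
  using local_occ_nonneg[of w i x] by auto

lemma integrable_power: "integrable (measure_pmf p) (\<lambda>x. type_mean G (\<lambda>w. local_occ G w i x ^ n))"
  using local_occ_power_le by (rule integrable_type_mean)

lemma integrable_local_occ: "integrable (measure_pmf p) (\<lambda>x. type_mean G (\<lambda>w. local_occ G w i x))"
  using integrable_power[of i 1] by simp

lemma integrable_shortfall:
  "a \<le> 1 \<Longrightarrow> integrable (measure_pmf p) (\<lambda>x. type_mean G (\<lambda>w. max 0 (a - local_occ G w i x)))"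
  using shortfall_bounds by (rule integrable_type_mean)

lemma mean_occ_le_1: "mean_occ G p i \<le> 1"
proof -
  have "mean_occ G p i \<le> E (\<lambda>_. 1)"
    unfolding mean_occ_def using occupancy_bounds integrable_occupancy by (intro integral_mono) auto
  thus ?thesis by simp
qed

lemma mean_occ_0: "mean_occ G p 0 = 1"
proof -
  have "occupancy G 0 = (\<lambda>_. 1)" by (simp add: fun_eq_iff occupancy_0)
  thus ?thesis by (simp add: mean_occ_def)
qed

text \<open>
  Every queue is finite in every state, so for a fixed graph this is dominated convergence.
\<close>

lemma mean_occ_tendsto_0: "(\<lambda>i. mean_occ G p i) \<longlonglongrightarrow> 0"
proof -
  have "(\<lambda>i. mean_occ G p i) \<longlonglongrightarrow> E (\<lambda>_. 0)"
    unfolding mean_occ_def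
  proof (rule integral_dominated_convergence[where w = "\<lambda>_. 1"])
    have "(\<lambda>i. occupancy G i x) \<longlonglongrightarrow> 0" for x
    proof -
      have "(\<lambda>i. of_bool (i \<le> x v) :: real) \<longlonglongrightarrow> 0" for v
        by (rule tendsto_eventually, rule eventually_sequentiallyI[of "Suc (x v)"]) auto
      hence "(\<lambda>i. 1 / nV * (\<Sum>v \<in> V. of_bool (i \<le> x v))) \<longlonglongrightarrow> 1 / nV * (\<Sum>v \<in> V. 0)"
        by (intro tendsto_intros)
      thus ?thesis by (simp add: occupancy_def)
    qed
    thus "AE x in measure_pmf p. (\<lambda>i. occupancy G i x) \<longlonglongrightarrow> 0" by simp
    show "AE x in measure_pmf p. norm (occupancy G i x) \<le> 1" for i
      using occupancy_bounds by simp
  qed auto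
  thus ?thesis by simp
qed

lemma mean_local_occ_phi:
  "\<bar>E (\<lambda>x. type_mean G (\<lambda>w. local_occ G w i x)) - mean_occ G p i\<bar> \<le> phi G * mean_occ G p i"
proof -
  have "\<bar>E (\<lambda>x. type_mean G (\<lambda>w. local_occ G w i x)) - mean_occ G p i\<bar>
     = \<bar>E (\<lambda>x. type_mean G (\<lambda>w. local_occ G w i x) - occupancy G i x)\<bar>"
    unfolding mean_occ_def using integrable_occupancy integrable_local_occ
    by (simp add: Bochner_Integration.integral_diff)
  also have "\<dots> \<le> E (\<lambda>x. \<bar>type_mean G (\<lambda>w. local_occ G w i x) - occupancy G i x\<bar>)"
    by (rule integral_abs_bound)
  also have "\<dots> \<le> E (\<lambda>x. phi G * occupancy G i x)"
    using integrable_occupancy integrable_local_occ type_mean_local_occ_phi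
    by (intro integral_mono) auto
  finally show ?thesis by (simp add: mean_occ_def)
qed

lemma mean_power_le: "E (\<lambda>x. type_mean G (\<lambda>w. local_occ G w i x ^ d)) \<le> E (\<lambda>x. type_mean G (\<lambda>w. local_occ G w i x))"
  using d_ge_1 local_occ_nonneg local_occ_le_1
  by (intro integral_mono integrable_power integrable_local_occ type_mean_mono)
     (auto intro: power_le_one_iff[THEN iffD2] simp: power_decreasing[of 1 d, simplified])

text \<open>
  The drift of a single occupancy only shows that the difference of the two sides is the same for all
  \<open>i\<close>; it is zero since both sides vanish as \<open>i\<close> tends to infinity. The unbounded function that
  counts all tasks beyond the \<open>i\<close>-th at each server would give the identity directly, but the
  generator identity is only available for bounded functions.
\<close>

lemma mean_occ_balance:
  "mean_occ G p (Suc i) = lam * E (\<lambda>x. type_mean G (\<lambda>w. local_occ G w i x ^ d))"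
proof -
  define Q where "Q i = E (\<lambda>x. type_mean G (\<lambda>w. local_occ G w i x ^ d))" for i
  define c where "c i = mean_occ G p (Suc i) - lam * Q i" for i
  have step: "c (Suc i) = c i" for i
  proof -
    have "0 = E (queue_drift lam d G (occupancy G (Suc i)))"
      using occupancy_bounds by (intro stationary_queue_drift(2)[OF stationary, of _ 1, symmetric]) auto
    also have "\<dots> = lam * (Q i - Q (Suc i)) - (mean_occ G p (Suc i) - mean_occ G p (Suc (Suc i)))"
      unfolding queue_drift_occupancy Q_def mean_occ_def using integrable_power integrable_occupancy
      by (simp add: queue_drift_occupancy cong: Bochner_Integration.integral_cong)
    finally show ?thesis by (simp add: c_def algebra_simps)
  qed
  have c0: "c i = c 0" for i by (induction i) (auto simp: step)
  have "Q \<longlonglongrightarrow> 0"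
  proof (rule tendsto_sandwich[OF _ _ tendsto_const])
    show "\<forall>\<^sub>F i in sequentially. 0 \<le> Q i"
      using local_occ_nonneg unfolding Q_def
      by (intro always_eventually allI Bochner_Integration.integral_nonneg) (auto simp: type_mean_def intro!: divide_nonneg_nonneg sum_nonneg)
    have "Q i \<le> (1 + phi G) * mean_occ G p i" for i
      using mean_power_le[of i] mean_local_occ_phi[of i] by (simp add: Q_def distrib_right)
    thus "\<forall>\<^sub>F i in sequentially. Q i \<le> (1 + phi G) * mean_occ G p i" by simp
    show "(\<lambda>i. (1 + phi G) * mean_occ G p i) \<longlonglongrightarrow> 0"
      using mean_occ_tendsto_0 by (rule tendsto_mult_right_zero)
  qed
  moreover have "(\<lambda>i. mean_occ G p (Suc i)) \<longlonglongrightarrow> 0"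
    using mean_occ_tendsto_0 by (rule LIMSEQ_Suc)
  ultimately have "c \<longlonglongrightarrow> 0 - lam * 0"
    unfolding c_def by (intro tendsto_intros)
  moreover have "c \<longlonglongrightarrow> c 0"
    by (intro tendsto_eventually always_eventually allI c0)
  ultimately have "c 0 = 0" by (simp add: LIMSEQ_unique)
  thus ?thesis using c0[of i] by (simp add: c_def Q_def)
qed

lemma mean_occ_le_rho_power: "mean_occ G p i \<le> rho lam G ^ i"
proof (induction i)
  case 0
  show ?case by (simp add: mean_occ_0)
next
  case (Suc i)
  have "mean_occ G p (Suc i) \<le> E (\<lambda>x. lam * type_mean G (\<lambda>w. local_occ G w i x))"
    using mean_power_le[of i] lam_pos by (simp add: mean_occ_balance)
  also have "\<dots> \<le> E (\<lambda>x. rho lam G * occupancy G i x)"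
    using integrable_occupancy integrable_local_occ type_mean_local_occ_rho by (intro integral_mono) auto
  also have "\<dots> = rho lam G * mean_occ G p i" by (simp add: mean_occ_def)
  also have "\<dots> \<le> rho lam G * rho lam G ^ i" using Suc rho_nonneg by (rule mult_left_mono)
  finally show ?case by simp
qed

lemma mean_shortfall_nonneg: "0 \<le> mean_shortfall G p i a"
  unfolding mean_shortfall_def
  by (intro Bochner_Integration.integral_nonneg) (auto simp: type_mean_def intro!: divide_nonneg_nonneg sum_nonneg)

lemma mean_shortfall_mono: "a \<le> b \<Longrightarrow> b \<le> 1 \<Longrightarrow> mean_shortfall G p i a \<le> mean_shortfall G p i b"
  unfolding mean_shortfall_def by (intro integral_mono integrable_shortfall type_mean_mono) auto

lemma mean_shortfall_add_le:
  assumes "a \<le> b" "b \<le> 1"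
  shows "mean_shortfall G p i b \<le> mean_shortfall G p i a + (b - a)"
proof -
  have "mean_shortfall G p i b \<le> E (\<lambda>x. type_mean G (\<lambda>w. max 0 (a - local_occ G w i x)) + (b - a))"
    unfolding mean_shortfall_def
  proof (intro integral_mono integrable_shortfall)
    fix x
    have "type_mean G (\<lambda>w. max 0 (b - local_occ G w i x)) 
      \<le> type_mean G (\<lambda>w. max 0 (a - local_occ G w i x) + (b - a))"
      using assms by (intro type_mean_mono) auto
    thus "type_mean G (\<lambda>w. max 0 (b - local_occ G w i x)) 
      \<le> type_mean G (\<lambda>w. max 0 (a - local_occ G w i x)) + (b - a)"
      by (simp only: type_mean_add type_mean_const)
  qed (use assms integrable_shortfall in auto)
  also have "\<dots> = mean_shortfall G p i a + (b - a)"
    unfolding mean_shortfall_def using integrable_shortfall[of a i] assms by simp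
  finally show ?thesis .
qed

lemma mean_shortfall_ge:
  assumes "a \<le> 1"
  shows "a - (1 + phi G) * mean_occ G p i \<le> mean_shortfall G p i a"
proof -
  have "a - (1 + phi G) * mean_occ G p i \<le> a - E (\<lambda>x. type_mean G (\<lambda>w. local_occ G w i x))"
    using mean_local_occ_phi[of i] by (simp add: distrib_right)
  also have "\<dots> = E (\<lambda>x. a - type_mean G (\<lambda>w. local_occ G w i x))"
    using integrable_local_occ by simp
  also have "\<dots> \<le> mean_shortfall G p i a"
    unfolding mean_shortfall_def
  proof (intro integral_mono integrable_shortfall assms)
    fix x
    have "type_mean G (\<lambda>w. a - local_occ G w i x) \<le> type_mean G (\<lambda>w. max 0 (a - local_occ G w i x))"
      by (intro type_mean_mono) auto
    thus "a - type_mean G (\<lambda>w. local_occ G w i x) \<le> type_mean G (\<lambda>w. max 0 (a - local_occ G w i x))"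
      by (simp only: type_mean_diff type_mean_const)
  qed (use integrable_local_occ in auto)
  finally show ?thesis .
qed

lemma mean_shortfall_0: "a \<le> 1 \<Longrightarrow> mean_shortfall G p 0 a = 0"
  unfolding mean_shortfall_def by (simp add: local_occ_0 type_mean_def)

lemma mean_sq_shortfall_le:
  assumes s: "0 \<le> s" "s \<le> 1" and t: "0 \<le> t" "t \<le> 1" and u: "0 \<le> u" "u \<le> 1" and b1: "b \<le> 1"
    and b: "(1 + lam * power_slope d s t) * b = lam * power_slope d s t * s + u"
  shows "2 * E (\<lambda>x. type_mean G (\<lambda>w. (max 0 (b - local_occ G w (Suc i) x))\<^sup>2)) \<le>
     2 * (real d * mean_shortfall G p i s + mean_shortfall G p (Suc (Suc i)) u + real d * phi G
         + real (d * d) * (1 + phi G) * (mean_shortfall G p i s + mean_shortfall G p (Suc i) t))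
     + (real d * (1 + phi G) + 1) * gamma G"
proof -
  let ?m = "\<lambda>a i x. type_mean G (\<lambda>w. max 0 (a - local_occ G w i x))"
  let ?f = "\<lambda>x. type_mean G (\<lambda>w. (max 0 (b - local_occ G w (Suc i) x))\<^sup>2)"
  let ?r = "\<lambda>x. 2 * (real d * ?m s i x + ?m u (Suc (Suc i)) x + real d * phi G
         + real (d * d) * (1 + phi G) * (?m s i x + ?m t (Suc i) x))
     + (real d * (1 + phi G) + 1) * gamma G"
  have sq: "\<bar>(max 0 (b - local_occ G w (Suc i) x))\<^sup>2\<bar> \<le> 1" for w x
    using b1 local_occ_nonneg[of w "Suc i" x] by (simp add: power_le_one)
  have f: "integrable (measure_pmf p) ?f"
    by (rule integrable_type_mean[OF sq])
  note int = integrable_shortfall[OF s(2), of i] integrable_shortfall[OF t(2), of "Suc i"] 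
     integrable_shortfall[OF u(2), of "Suc (Suc i)"]
  have drift: "queue_drift lam d G ?f x \<le> - 2 * ?f x + ?r x" for x
    using queue_drift_sq_shortfall[OF s t u b, of i x] by simp
  note dr = stationary_queue_drift[OF stationary, of ?f 1, OF type_mean_bounded[OF sq]]
  have "0 = E (queue_drift lam d G ?f)" using dr(2) by simp
  also have "\<dots> \<le> E (\<lambda>x. - 2 * ?f x + ?r x)"
    using dr(1) f int drift by (intro integral_mono) auto
  also have "\<dots> = - 2 * E ?f + (2 * (real d * mean_shortfall G p i s + mean_shortfall G p (Suc (Suc i)) u + real d * phi G
         + real (d * d) * (1 + phi G) * (mean_shortfall G p i s + mean_shortfall G p (Suc i) t))
     + (real d * (1 + phi G) + 1) * gamma G)"
    unfolding mean_shortfall_def using f int by simp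
  finally show ?thesis by simp
qed

text \<open>
  From \<open>y \<le> \<epsilon> + y^2 / \<epsilon>\<close>, so that vanishing mean squares force vanishing means.
\<close>

lemma mean_shortfall_le_sq:
  assumes "b \<le> 1" "\<epsilon> > 0"
  shows "mean_shortfall G p i b \<le> \<epsilon> + E (\<lambda>x. type_mean G (\<lambda>w. (max 0 (b - local_occ G w i x))\<^sup>2)) / \<epsilon>"
proof -
  have "\<bar>(max 0 (b - local_occ G w i x))\<^sup>2\<bar> \<le> 1" for w x
    using assms(1) local_occ_nonneg[of w i x] by (simp add: power_le_one)
  hence int: "integrable (measure_pmf p) (\<lambda>x. type_mean G (\<lambda>w. (max 0 (b - local_occ G w i x))\<^sup>2))"
    by (intro integrable_type_mean)
  have "mean_shortfall G p i b \<le> E (\<lambda>x. \<epsilon> + 1 / \<epsilon> * type_mean G (\<lambda>w. (max 0 (b - local_occ G w i x))\<^sup>2))"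
    unfolding mean_shortfall_def
  proof (intro integral_mono integrable_shortfall assms)
    fix x
    have sq: "y \<le> \<epsilon> + 1 / \<epsilon> * y\<^sup>2" if "y \<ge> 0" for y
    proof (cases "y \<le> \<epsilon>")
      case True
      thus ?thesis using assms by (simp add: add_increasing2)
    next
      case False
      hence "\<epsilon> * y \<le> y * y" using that by (intro mult_right_mono) auto
      thus ?thesis using assms by (simp add: field_simps power2_eq_square add_increasing)
    qed
    have "type_mean G (\<lambda>w. max 0 (b - local_occ G w i x))
        \<le> type_mean G (\<lambda>w. \<epsilon> + 1 / \<epsilon> * (max 0 (b - local_occ G w i x))\<^sup>2)"
      by (intro type_mean_mono sq max.cobounded1)
    thus "type_mean G (\<lambda>w. max 0 (b - local_occ G w i x))
        \<le> \<epsilon> + 1 / \<epsilon> * type_mean G (\<lambda>w. (max 0 (b - local_occ G w i x))\<^sup>2)"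
      by (simp only: type_mean_add type_mean_const type_mean_cmult)
  qed (use int in auto)
  thus ?thesis using int by simp
qed

lemma mean_abs_local_occ:
  assumes "a \<le> 1"
  shows "E (\<lambda>x. type_mean G (\<lambda>w. \<bar>local_occ G w i x - a\<bar>))
    = E (\<lambda>x. type_mean G (\<lambda>w. local_occ G w i x)) - a + 2 * mean_shortfall G p i a"
proof -
  have "\<bar>y - a\<bar> = (y - a) + 2 * max 0 (a - y)" for y by (auto simp: max_def)
  hence "E (\<lambda>x. type_mean G (\<lambda>w. \<bar>local_occ G w i x - a\<bar>)) =
     E (\<lambda>x. (type_mean G (\<lambda>w. local_occ G w i x) - a) + 2 * type_mean G (\<lambda>w. max 0 (a - local_occ G w i x)))"
    by (simp only: type_mean_add type_mean_diff type_mean_const type_mean_cmult)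
  thus ?thesis
    unfolding mean_shortfall_def using integrable_local_occ[of i] integrable_shortfall[OF assms, of i] by simp
qed

lemma abs_local_occ_bounds:
  "w \<in> W \<Longrightarrow> 0 \<le> a \<Longrightarrow> a \<le> 1 \<Longrightarrow> \<bar>\<bar>local_occ G w i x - a\<bar>\<bar> \<le> 1"
  using local_occ_nonneg[of w i x] local_occ_le_1[of w i x] by (simp add: abs_le_iff)

lemma mean_power_diff_le:
  assumes "0 \<le> a" "a \<le> 1"
  shows "\<bar>E (\<lambda>x. type_mean G (\<lambda>w. local_occ G w i x ^ d)) - a ^ d\<bar>
    \<le> real d * E (\<lambda>x. type_mean G (\<lambda>w. \<bar>local_occ G w i x - a\<bar>))"
proof -
  have int: "integrable (measure_pmf p) (\<lambda>x. type_mean G (\<lambda>w. \<bar>local_occ G w i x - a\<bar>))"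
    using abs_local_occ_bounds assms by (intro integrable_type_mean)
  have "\<bar>E (\<lambda>x. type_mean G (\<lambda>w. local_occ G w i x ^ d)) - a ^ d\<bar> =
     \<bar>E (\<lambda>x. type_mean G (\<lambda>w. local_occ G w i x ^ d) - a ^ d)\<bar>"
    using integrable_power[of i d] by simp
  also have "\<dots> \<le> E (\<lambda>x. \<bar>type_mean G (\<lambda>w. local_occ G w i x ^ d) - a ^ d\<bar>)"
    by (rule integral_abs_bound)
  also have "\<dots> \<le> E (\<lambda>x. real d * type_mean G (\<lambda>w. \<bar>local_occ G w i x - a\<bar>))"
  proof (intro integral_mono)
    fix x
    have "\<bar>type_mean G (\<lambda>w. local_occ G w i x ^ d) - a ^ d\<bar>
       = \<bar>type_mean G (\<lambda>w. local_occ G w i x ^ d - a ^ d)\<bar>"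
      by (simp only: type_mean_diff type_mean_const)
    also have "\<dots> \<le> type_mean G (\<lambda>w. \<bar>local_occ G w i x ^ d - a ^ d\<bar>)"
      by (rule abs_type_mean_le)
    also have "\<dots> \<le> type_mean G (\<lambda>w. real d * \<bar>local_occ G w i x - a\<bar>)"
    proof (rule type_mean_mono)
      fix w assume w: "w \<in> W"
      note q = local_occ_nonneg[of w i x] local_occ_le_1[OF w, of i x]
      have "\<bar>local_occ G w i x ^ d - a ^ d\<bar> = \<bar>local_occ G w i x - a\<bar> * power_slope d (local_occ G w i x) a"
        using power_slope_nonneg[of "local_occ G w i x" a d] q assms
        by (simp add: abs_mult flip: power_slope_mult)
      also have "\<dots> \<le> \<bar>local_occ G w i x - a\<bar> * real d"
        using q assms by (intro mult_left_mono power_slope_le) auto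
      finally show "\<bar>local_occ G w i x ^ d - a ^ d\<bar> \<le> real d * \<bar>local_occ G w i x - a\<bar>"
        by (simp add: mult.commute)
    qed
    finally show "\<bar>type_mean G (\<lambda>w. local_occ G w i x ^ d) - a ^ d\<bar>
        \<le> real d * type_mean G (\<lambda>w. \<bar>local_occ G w i x - a\<bar>)"
      by (simp only: type_mean_cmult)
  qed (use int integrable_power[of i d] in auto)
  finally show ?thesis by simp
qed

lemma integrable_sq_deviation: "integrable (measure_pmf p) (\<lambda>x. (occupancy G i x - a)\<^sup>2)"
proof (rule integrable_pmf_bounded)
  fix x
  have "\<bar>occupancy G i x - a\<bar> \<le> 1 + \<bar>a\<bar>"
    using occupancy_bounds[of i x] by linarith
  thus "\<bar>(occupancy G i x - a)\<^sup>2\<bar> \<le> (1 + \<bar>a\<bar>)\<^sup>2"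
    using power_mono[of "\<bar>occupancy G i x - a\<bar>" "1 + \<bar>a\<bar>" 2] by simp
qed

lemma mean_sq_deviation_le:
  assumes "0 \<le> a" "a \<le> 1"
  shows "E (\<lambda>x. (occupancy G i x - a)\<^sup>2) \<le> phi G + E (\<lambda>x. type_mean G (\<lambda>w. \<bar>local_occ G w i x - a\<bar>))"
proof -
  have int: "integrable (measure_pmf p) (\<lambda>x. type_mean G (\<lambda>w. \<bar>local_occ G w i x - a\<bar>))"
    using abs_local_occ_bounds assms by (intro integrable_type_mean)
  have "E (\<lambda>x. (occupancy G i x - a)\<^sup>2) \<le> E (\<lambda>x. phi G + type_mean G (\<lambda>w. \<bar>local_occ G w i x - a\<bar>))"
  proof (intro integral_mono integrable_sq_deviation)
    fix x
    have "\<bar>occupancy G i x - a\<bar> \<le> 1" using occupancy_bounds[of i x] assms by (simp add: abs_le_iff)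
    hence "(occupancy G i x - a)\<^sup>2 \<le> \<bar>occupancy G i x - a\<bar>"
      using mult_left_mono[of "\<bar>occupancy G i x - a\<bar>" 1 "\<bar>occupancy G i x - a\<bar>"]
      by (simp add: power2_eq_square flip: abs_mult)
    also have "\<dots> \<le> \<bar>type_mean G (\<lambda>w. local_occ G w i x) - occupancy G i x\<bar> +
       \<bar>type_mean G (\<lambda>w. local_occ G w i x) - a\<bar>" by linarith
    also have "\<bar>type_mean G (\<lambda>w. local_occ G w i x) - occupancy G i x\<bar> \<le> phi G * occupancy G i x"
      by (rule type_mean_local_occ_phi)
    also have "\<dots> \<le> phi G * 1" using occupancy_bounds phi_nonneg by (intro mult_left_mono)
    also have "type_mean G (\<lambda>w. local_occ G w i x) - a = type_mean G (\<lambda>w. local_occ G w i x - a)"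
      by (simp only: type_mean_diff type_mean_const)
    also have "\<bar>\<dots>\<bar> \<le> type_mean G (\<lambda>w. \<bar>local_occ G w i x - a\<bar>)" by (rule abs_type_mean_le)
    finally show "(occupancy G i x - a)\<^sup>2 \<le> phi G + type_mean G (\<lambda>w. \<bar>local_occ G w i x - a\<bar>)" by simp
  qed (use int in auto)
  thus ?thesis using int by simp
qed

text \<open>
  A bound for high levels, where both the occupancy and \<open>a\<close> are small.
\<close>

lemma mean_sq_deviation_tail:
  assumes "0 \<le> a" "a \<le> 1"
  shows "E (\<lambda>x. (occupancy G i x - a)\<^sup>2) \<le> mean_occ G p i + a"
proof -
  have "E (\<lambda>x. (occupancy G i x - a)\<^sup>2) \<le> E (\<lambda>x. occupancy G i x + a)"
  proof (intro integral_mono integrable_sq_deviation)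
    fix x
    note q = occupancy_bounds[of i x]
    have "(occupancy G i x - a)\<^sup>2 = occupancy G i x * occupancy G i x + a * a - 2 * (occupancy G i x * a)"
      by (simp add: power2_eq_square algebra_simps)
    moreover have "0 \<le> occupancy G i x * a" using q assms by simp
    moreover have "occupancy G i x * occupancy G i x \<le> occupancy G i x" "a * a \<le> a"
      using q assms by (auto intro: mult_left_le)
    ultimately show "(occupancy G i x - a)\<^sup>2 \<le> occupancy G i x + a" by linarith
  qed (use integrable_occupancy in auto)
  thus ?thesis using integrable_occupancy by (simp add: mean_occ_def)
qed

end

section \<open>Large systems\<close>

lemma q_star_0: "lam > 0 \<Longrightarrow> q_star lam d 0 = 1"
  by (simp add: q_star_def)

lemma q_star_Suc:
  assumes "lam > 0" "d \<ge> 2"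
  shows "q_star lam d (Suc i) = lam * q_star lam d i ^ d"
proof -
  have d: "real d - 1 \<noteq> 0" using assms by simp
  have "(real d ^ Suc i - 1) / (real d - 1) = 1 + real d * ((real d ^ i - 1) / (real d - 1))"
    using d by (simp add: field_simps)
  hence "q_star lam d (Suc i) = lam * lam powr (real d * ((real d ^ i - 1) / (real d - 1)))"
    using assms by (simp add: q_star_def powr_add)
  also have "lam powr (real d * ((real d ^ i - 1) / (real d - 1))) = q_star lam d i powr real d"
    by (simp add: q_star_def powr_powr mult.commute)
  also have "\<dots> = q_star lam d i ^ d"
    using assms by (intro powr_realpow) (simp add: q_star_def)
  finally show ?thesis .
qed

lemma tendsto_0_by_approx:
  fixes f :: "nat \<Rightarrow> real"
  assumes "\<forall>\<^sub>F N in sequentially. 0 \<le> f N"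
    and "\<And>e. e > 0 \<Longrightarrow> \<exists>g. g \<longlonglongrightarrow> 0 \<and> (\<forall>\<^sub>F N in sequentially. f N \<le> e + g N)"
  shows "f \<longlonglongrightarrow> 0"
proof (rule order_tendstoI)
  fix a :: real assume "a < 0"
  show "\<forall>\<^sub>F N in sequentially. a < f N"
    using assms(1) by eventually_elim (use \<open>a < 0\<close> in simp)
next
  fix a :: real assume "0 < a"
  then obtain g where g: "g \<longlonglongrightarrow> 0" "\<forall>\<^sub>F N in sequentially. f N \<le> a / 2 + g N"
    using assms(2)[of "a / 2"] by auto
  have "\<forall>\<^sub>F N in sequentially. g N < a / 2" 
    by (rule order_tendstoD(2)[OF g(1)]) (use \<open>0 < a\<close> in simp)
  with g(2) show "\<forall>\<^sub>F N in sequentially. f N < a" by eventually_elim simp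
qed

locale queue_sequence =
  fixes G :: "nat \<Rightarrow> ('v, 'w) compat_graph" and p :: "nat \<Rightarrow> ('v \<Rightarrow> nat) pmf"
    and lam rho0 :: real and d :: nat
  assumes lam_pos: "0 < lam" and lam_less_1: "lam < 1" and d_ge_2: "d \<ge> 2"
    and compat: "\<And>N. N \<ge> 1 \<Longrightarrow> compatibility_graph (G N)"
    and stationary: "\<And>N. N \<ge> 1 \<Longrightarrow>
           stationary_distribution (queue_states (G N)) (queue_rate lam d (G N)) (p N)"
    and rho_le: "\<And>N. N \<ge> 1 \<Longrightarrow> rho lam (G N) \<le> rho0" and rho0_less_1: "rho0 < 1"
    and phi_tendsto: "(\<lambda>N. phi (G N)) \<longlonglongrightarrow> 0" and gamma_tendsto: "(\<lambda>N. gamma (G N)) \<longlonglongrightarrow> 0"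
begin

lemma queues: "N \<ge> 1 \<Longrightarrow> stationary_queues (G N) lam d (p N)"
  using d_ge_2
  by (intro stationary_queues.intro compat_queues.intro stationary_queues_axioms.intro
        compat stationary lam_pos lam_less_1) auto

abbreviation "shortfall N i a \<equiv> mean_shortfall (G N) (p N) i a"

lemma eventually_queues: "\<forall>\<^sub>F N in sequentially. stationary_queues (G N) lam d (p N)"
  using eventually_ge_at_top[of 1] by eventually_elim (rule queues)

lemma rho0_nonneg: "0 \<le> rho0"
proof -
  interpret stationary_queues "G 1" lam d "p 1" by (rule queues) simp
  show ?thesis using rho_nonneg rho_le[of 1] by simp
qed

definition lower_level :: "nat \<Rightarrow> real \<Rightarrow> bool" where
  "lower_level i a \<longleftrightarrow> 0 \<le> a \<and> a \<le> 1 \<and> (\<lambda>N. shortfall N i a) \<longlonglongrightarrow> 0"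

text \<open>
  The best asymptotic lower bound for the occupancies of level \<open>i\<close> at typical task types.
\<close>

definition level :: "nat \<Rightarrow> real" where
  "level i = Sup {a. lower_level i a}"

lemma shortfall_nonneg: "\<forall>\<^sub>F N in sequentially. 0 \<le> shortfall N i a"
  using eventually_queues by eventually_elim (rule stationary_queues.mean_shortfall_nonneg)

lemma lower_level_mono:
  assumes "lower_level i b" "0 \<le> a" "a \<le> b"
  shows "lower_level i a"
proof -
  have "(\<lambda>N. shortfall N i a) \<longlonglongrightarrow> 0"
  proof (rule tendsto_sandwich[OF shortfall_nonneg _ tendsto_const])
    show "(\<lambda>N. shortfall N i b) \<longlonglongrightarrow> 0" using assms by (simp add: lower_level_def)
    show "\<forall>\<^sub>F N in sequentially. shortfall N i a \<le> shortfall N i b"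
      using eventually_queues
      by eventually_elim (use assms in \<open>auto simp: lower_level_def intro: stationary_queues.mean_shortfall_mono\<close>)
  qed
  thus ?thesis using assms by (simp add: lower_level_def)
qed

lemma lower_level_0: "lower_level i 0"
proof -
  have "\<forall>\<^sub>F N in sequentially. shortfall N i 0 = 0"
    using eventually_queues
  proof eventually_elim
    case (elim N)
    interpret stationary_queues "G N" lam d "p N" by fact
    have "max 0 (0 - local_occ (G N) w i x) = 0" for w x
      using local_occ_nonneg[of w i x] by simp
    thus ?case by (simp add: mean_shortfall_def type_mean_def)
  qed
  thus ?thesis by (simp add: lower_level_def tendsto_eventually)
qed

lemma lower_level_le_level: "lower_level i a \<Longrightarrow> a \<le> level i"
  unfolding level_def by (rule cSup_upper) (auto simp: bdd_above_def lower_level_def)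

lemma level_bounds: "0 \<le> level i" "level i \<le> 1"
proof -
  show "0 \<le> level i" using lower_level_0 by (rule lower_level_le_level)
  show "level i \<le> 1" unfolding level_def
    by (rule cSup_least) (use lower_level_0 in blast, simp add: lower_level_def)
qed

text \<open>
  The supremum is attained because the shortfall is 1-Lipschitz in the bound, uniformly in \<open>N\<close>.
\<close>

lemma lower_level_level: "lower_level i (level i)"
proof -
  have "(\<lambda>N. shortfall N i (level i)) \<longlonglongrightarrow> 0"
  proof (rule tendsto_0_by_approx[OF shortfall_nonneg])
    fix e :: real assume "e > 0"
    hence "level i - e < Sup {a. lower_level i a}" by (simp add: level_def)
    then obtain a where a: "lower_level i a" "level i - e < a"
    proof (subst (asm) less_cSup_iff)
      show "{a. lower_level i a} \<noteq> {}" using lower_level_0 by blast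
      show "bdd_above {a. lower_level i a}" by (auto simp: bdd_above_def lower_level_def)
    qed blast
    have "\<forall>\<^sub>F N in sequentially. shortfall N i (level i) \<le> e + shortfall N i a"
      using eventually_queues
    proof eventually_elim
      case (elim N)
      have "shortfall N i (level i) \<le> shortfall N i a + (level i - a)"
        using elim lower_level_le_level[OF a(1)] level_bounds(2)
        by (rule stationary_queues.mean_shortfall_add_le)
      thus ?case using a by simp
    qed
    thus "\<exists>g. g \<longlonglongrightarrow> 0 \<and> (\<forall>\<^sub>F N in sequentially. shortfall N i (level i) \<le> e + g N)"
      using a(1) by (auto simp: lower_level_def)
  qed
  thus ?thesis using level_bounds by (simp add: lower_level_def)
qed

lemma shortfall_level: "(\<lambda>N. shortfall N i (level i)) \<longlonglongrightarrow> 0"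
  using lower_level_level by (simp add: lower_level_def)

lemma level_0: "level 0 = 1"
proof -
  have "\<forall>\<^sub>F N in sequentially. shortfall N 0 1 = 0"
    using eventually_queues by eventually_elim (simp add: stationary_queues.mean_shortfall_0)
  hence "lower_level 0 1" by (simp add: lower_level_def tendsto_eventually)
  thus ?thesis using lower_level_le_level level_bounds(2) by (force intro: antisym)
qed

lemma mean_occ_le_rho0_power: "N \<ge> 1 \<Longrightarrow> mean_occ (G N) (p N) i \<le> rho0 ^ i"
proof -
  assume N: "N \<ge> 1"
  interpret stationary_queues "G N" lam d "p N" using N by (rule queues)
  have "mean_occ (G N) (p N) i \<le> rho lam (G N) ^ i" by (rule mean_occ_le_rho_power)
  also have "\<dots> \<le> rho0 ^ i" using rho_nonneg rho_le[OF N] by (intro power_mono)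
  finally show ?thesis .
qed

text \<open>
  A lower bound for the local occupancies cannot exceed their mean, which is geometrically small.
\<close>

lemma level_le_rho0_power: "level i \<le> rho0 ^ i"
proof -
  have "(\<lambda>N. level i - (1 + phi (G N)) * rho0 ^ i) \<longlonglongrightarrow> level i - (1 + 0) * rho0 ^ i"
    by (intro tendsto_intros phi_tendsto)
  moreover have "\<forall>\<^sub>F N in sequentially. level i - (1 + phi (G N)) * rho0 ^ i \<le> shortfall N i (level i)"
    using eventually_ge_at_top[of 1]
  proof eventually_elim
    case (elim N)
    interpret stationary_queues "G N" lam d "p N" using elim by (rule queues)
    have "(1 + phi (G N)) * mean_occ (G N) (p N) i \<le> (1 + phi (G N)) * rho0 ^ i"
      using mean_occ_le_rho0_power[OF elim] phi_nonneg by (intro mult_left_mono) auto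
    thus ?case using mean_shortfall_ge[OF level_bounds(2)[of i], of i] by linarith
  qed
  ultimately have "level i - (1 + 0) * rho0 ^ i \<le> 0"
    using shortfall_level by (intro tendsto_le[OF sequentially_bot])
  thus ?thesis by simp
qed

text \<open>
  The zero \<open>b\<close> of the linearised drift at the levels \<open>level i\<close>, \<open>level (Suc i)\<close> and
  \<open>level (Suc (Suc i))\<close> is again an asymptotic lower bound for level \<open>Suc i\<close>, so it cannot exceed
  the best one. Rearranged with the defining property of the slope, this is the claim.
\<close>

lemma level_drift:
  "level (Suc (Suc i)) - lam * level (Suc i) ^ d \<le> level (Suc i) - lam * level i ^ d"
proof -
  let ?s = "level i" and ?t = "level (Suc i)" and ?u = "level (Suc (Suc i))"
  define h where "h = power_slope d ?s ?t"
  have h0: "0 \<le> lam * h" using lam_pos level_bounds by (simp add: h_def power_slope_nonneg)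
  \<comment> \<open>A convex combination of two levels, hence in the unit interval.\<close>
  define b where "b = (lam * h * ?s + ?u) / (1 + lam * h)"
  have b: "(1 + lam * h) * b = lam * h * ?s + ?u" using h0 by (simp add: b_def)
  have b0: "0 \<le> b" using h0 level_bounds by (simp add: b_def)
  have "lam * h * ?s \<le> lam * h * 1" using level_bounds h0 by (intro mult_left_mono) auto
  hence b1: "b \<le> 1" using h0 level_bounds(2)[of "Suc (Suc i)"] by (simp add: b_def)
  define err where "err N = 2 * (real d * shortfall N i ?s + shortfall N (Suc (Suc i)) ?u + real d * phi (G N)
         + real (d * d) * (1 + phi (G N)) * (shortfall N i ?s + shortfall N (Suc i) ?t))
     + (real d * (1 + phi (G N)) + 1) * gamma (G N)" for N
  have "err \<longlonglongrightarrow> 2 * (real d * 0 + 0 + real d * 0 + real (d * d) * (1 + 0) * (0 + 0))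
     + (real d * (1 + 0) + 1) * 0"
    unfolding err_def by (intro tendsto_intros shortfall_level phi_tendsto gamma_tendsto)
  hence err: "err \<longlonglongrightarrow> 0" by simp
  have "(\<lambda>N. shortfall N (Suc i) b) \<longlonglongrightarrow> 0"
  proof (rule tendsto_0_by_approx[OF shortfall_nonneg])
    fix e :: real assume e: "e > 0"
    have "\<forall>\<^sub>F N in sequentially. shortfall N (Suc i) b \<le> e + err N / 2 / e"
      using eventually_queues
    proof eventually_elim
      case (elim N)
      interpret stationary_queues "G N" lam d "p N" by fact
      let ?m2 = "E (\<lambda>x. type_mean (G N) (\<lambda>w. (max 0 (b - local_occ (G N) w (Suc i) x))\<^sup>2))"
      have "?m2 \<le> err N / 2"
        using mean_sq_shortfall_le[OF level_bounds level_bounds level_bounds b1 b[unfolded h_def], of i]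
        by (simp add: err_def)
      hence "?m2 / e \<le> err N / 2 / e" using e by (intro divide_right_mono) auto
      thus ?case using mean_shortfall_le_sq[OF b1 e, of "Suc i"] by linarith
    qed
    moreover have "(\<lambda>N. err N / 2 / e) \<longlonglongrightarrow> 0"
      using err by (simp add: tendsto_divide_zero)
    ultimately show "\<exists>g. g \<longlonglongrightarrow> 0 \<and> (\<forall>\<^sub>F N in sequentially. shortfall N (Suc i) b \<le> e + g N)"
      by (intro exI[of _ "\<lambda>N. err N / 2 / e"] conjI)
  qed
  hence "b \<le> ?t" using b0 b1 by (intro lower_level_le_level) (simp add: lower_level_def)
  hence "(1 + lam * h) * b \<le> (1 + lam * h) * ?t" using h0 by (intro mult_left_mono) auto
  hence "lam * ((?s - ?t) * h) + ?u \<le> ?t" unfolding b by (simp add: algebra_simps)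
  thus ?thesis unfolding h_def power_slope_mult by (simp add: right_diff_distrib)
qed

text \<open>
  The previous lemma states that \<open>level (Suc i) - \<lambda> (level i)^d\<close> is decreasing in \<open>i\<close>; its limit is
  zero because the levels tend to zero.
\<close>

lemma level_ge: "lam * level i ^ d \<le> level (Suc i)"
proof -
  define c where "c i = level (Suc i) - lam * level i ^ d" for i
  have geom: "(\<lambda>i. rho0 ^ i) \<longlonglongrightarrow> 0"
    using rho0_nonneg rho0_less_1 by (intro LIMSEQ_power_zero) simp
  have lev: "level \<longlonglongrightarrow> 0"
    by (rule tendsto_sandwich[OF _ _ tendsto_const geom])
       (simp_all add: level_bounds level_le_rho0_power)
  have "c \<longlonglongrightarrow> 0 - lam * 0 ^ d"
    unfolding c_def by (intro tendsto_intros lev LIMSEQ_Suc)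
  hence "c \<longlonglongrightarrow> 0" using d_ge_2 by (simp add: power_0_left)
  moreover have "decseq c"
    using level_drift by (intro decseq_SucI) (simp add: c_def)
  ultimately have "0 \<le> c i" by (intro decseq_ge)
  thus ?thesis by (simp add: c_def)
qed

abbreviation "qs i \<equiv> q_star lam d i"

lemma q_star_nonneg: "0 \<le> qs i" by (simp add: q_star_def)

lemma q_star_le_level: "qs i \<le> level i"
proof (induction i)
  case 0
  show ?case using lam_pos by (simp add: q_star_0 level_0)
next
  case (Suc i)
  have "qs (Suc i) = lam * qs i ^ d" using lam_pos d_ge_2 by (rule q_star_Suc)
  also have "\<dots> \<le> lam * level i ^ d"
    using Suc lam_pos q_star_nonneg by (intro mult_left_mono power_mono) auto
  also have "\<dots> \<le> level (Suc i)" by (rule level_ge)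
  finally show ?case .
qed

lemma q_star_le_1: "qs i \<le> 1"
  using q_star_le_level level_bounds(2) by (rule order_trans)

lemma shortfall_q_star: "(\<lambda>N. shortfall N i (qs i)) \<longlonglongrightarrow> 0"
  using lower_level_mono[OF lower_level_level q_star_nonneg q_star_le_level]
  by (simp add: lower_level_def)

abbreviation "deviation N i \<equiv>
  measure_pmf.expectation (p N) (\<lambda>x. type_mean (G N) (\<lambda>w. \<bar>local_occ (G N) w i x - qs i\<bar>))"

text \<open>
  The mean absolute deviation is the mean deviation plus twice the mean shortfall, and both vanish.
\<close>

lemma deviation_tendsto:
  assumes "(\<lambda>N. mean_occ (G N) (p N) i) \<longlonglongrightarrow> qs i"
  shows "(\<lambda>N. deviation N i) \<longlonglongrightarrow> 0"
proof (rule tendsto_sandwich[OF _ _ tendsto_const])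
  show "\<forall>\<^sub>F N in sequentially. 0 \<le> deviation N i"
    by (intro always_eventually allI Bochner_Integration.integral_nonneg)
       (simp add: type_mean_def sum_nonneg)
  show "\<forall>\<^sub>F N in sequentially. deviation N i
      \<le> phi (G N) + (mean_occ (G N) (p N) i - qs i) + 2 * shortfall N i (qs i)"
    using eventually_queues
  proof eventually_elim
    case (elim N)
    interpret stationary_queues "G N" lam d "p N" by fact
    have "phi (G N) * mean_occ (G N) (p N) i \<le> phi (G N) * 1"
      using mean_occ_le_1 phi_nonneg by (rule mult_left_mono)
    thus ?case
      unfolding mean_abs_local_occ[OF q_star_le_1] using mean_local_occ_phi[of i] by simp
  qed
  have "(\<lambda>N. phi (G N) + (mean_occ (G N) (p N) i - qs i) + 2 * shortfall N i (qs i))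
     \<longlonglongrightarrow> 0 + (qs i - qs i) + 2 * 0"
    by (intro tendsto_intros phi_tendsto shortfall_q_star assms)
  thus "(\<lambda>N. phi (G N) + (mean_occ (G N) (p N) i - qs i) + 2 * shortfall N i (qs i)) \<longlonglongrightarrow> 0"
    by simp
qed

text \<open>
  By induction along the balance identity: concentration of level \<open>i\<close> permits to exchange the
  \<open>d\<close>-th power with the mean, which gives the limit of the mean at the next level.
\<close>

lemma mean_occ_tendsto: "(\<lambda>N. mean_occ (G N) (p N) i) \<longlonglongrightarrow> qs i"
proof (induction i)
  case 0
  have "\<forall>\<^sub>F N in sequentially. mean_occ (G N) (p N) 0 = 1"
    using eventually_queues by eventually_elim (rule stationary_queues.mean_occ_0)
  thus ?case using lam_pos by (simp add: q_star_0 tendsto_eventually)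
next
  case (Suc i)
  have "(\<lambda>N. lam * (real d * deviation N i)) \<longlonglongrightarrow> lam * (real d * 0)"
    by (intro tendsto_intros deviation_tendsto Suc)
  hence lim: "(\<lambda>N. lam * (real d * deviation N i)) \<longlonglongrightarrow> 0" by simp
  have "\<forall>\<^sub>F N in sequentially. norm (mean_occ (G N) (p N) (Suc i) - qs (Suc i)) \<le> lam * (real d * deviation N i)"
    using eventually_queues
  proof eventually_elim
    case (elim N)
    interpret stationary_queues "G N" lam d "p N" by fact
    have "mean_occ (G N) (p N) (Suc i) - qs (Suc i) = 
      lam * (E (\<lambda>x. type_mean (G N) (\<lambda>w. local_occ (G N) w i x ^ d)) - qs i ^ d)"
      using lam_pos d_ge_2 by (simp add: mean_occ_balance q_star_Suc right_diff_distrib)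
    thus ?case using mean_power_diff_le[OF q_star_nonneg[of i] q_star_le_1[of i], of i] lam_pos
      by (simp add: abs_mult)
  qed
  hence "(\<lambda>N. mean_occ (G N) (p N) (Suc i) - qs (Suc i)) \<longlonglongrightarrow> 0"
    using lim by (rule Lim_null_comparison)
  thus ?case by (simp add: LIM_zero_iff)
qed

lemma sq_deviation_tendsto:
  "(\<lambda>N. measure_pmf.expectation (p N) (\<lambda>x. (occupancy (G N) i x - qs i)\<^sup>2)) \<longlonglongrightarrow> 0"
proof (rule tendsto_sandwich[OF _ _ tendsto_const])
  show "\<forall>\<^sub>F N in sequentially. measure_pmf.expectation (p N) (\<lambda>x. (occupancy (G N) i x - qs i)\<^sup>2)
      \<le> phi (G N) + deviation N i"
    using eventually_queues
    by eventually_elim (intro stationary_queues.mean_sq_deviation_le q_star_nonneg q_star_le_1)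
  show "(\<lambda>N. phi (G N) + deviation N i) \<longlonglongrightarrow> 0"
    using tendsto_add[OF phi_tendsto deviation_tendsto[OF mean_occ_tendsto]] by simp
qed simp

lemma sq_deviation_le:
  assumes "N \<ge> 1"
  shows "measure_pmf.expectation (p N) (\<lambda>x. (occupancy (G N) i x - qs i)\<^sup>2) \<le> 2 * rho0 ^ i"
proof -
  interpret stationary_queues "G N" lam d "p N" using assms by (rule queues)
  show ?thesis
    using mean_sq_deviation_tail[OF q_star_nonneg[of i] q_star_le_1[of i], of i]
      mean_occ_le_rho0_power[OF assms, of i] q_star_le_level[of i] level_le_rho0_power[of i] by linarith
qed

lemma suminf_sq_deviation_tendsto:
  "(\<lambda>N. \<Sum>i. ennreal (measure_pmf.expectation (p N)
      (\<lambda>x. (occupancy (G N) (Suc i) x - qs (Suc i))\<^sup>2))) \<longlonglongrightarrow> 0"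
proof -
  define a where "a i N = measure_pmf.expectation (p N) (\<lambda>x. (occupancy (G N) (Suc i) x - qs (Suc i))\<^sup>2)"
    for i N
  have a0: "0 \<le> a i N" for i N by (simp add: a_def)
  have bound: "norm (a i N) \<le> 2 * rho0 ^ Suc i" if "N \<ge> 1" for i N
    using sq_deviation_le[OF that, of "Suc i"] a0[of i N] by (simp add: a_def)
  have summ: "summable (\<lambda>i. 2 * rho0 ^ Suc i)"
    using rho0_nonneg rho0_less_1 by (intro summable_mult) (simp add: summable_geometric summable_Suc_iff del: power_Suc)
  have "eventually (\<lambda>(i, N). norm (a i N) \<le> 2 * rho0 ^ Suc i) (at_top \<times>\<^sub>F sequentially)"
    unfolding eventually_prod_filter
    using bound by (intro exI[of _ "\<lambda>_. True"] exI[of _ "\<lambda>N. N \<ge> 1"]) (auto simp: eventually_ge_at_top)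
  from tannerys_theorem[OF _ this summ, of "\<lambda>_. 0"]
  have "(\<lambda>N. \<Sum>i. a i N) \<longlonglongrightarrow> 0"
    using sq_deviation_tendsto by (simp add: a_def)
  hence "(\<lambda>N. ennreal (\<Sum>i. a i N)) \<longlonglongrightarrow> ennreal 0"
    by (rule tendsto_ennrealI)
  moreover have "\<forall>\<^sub>F N in sequentially. (\<Sum>i. ennreal (a i N)) = ennreal (\<Sum>i. a i N)"
    using eventually_ge_at_top[of 1]
  proof eventually_elim
    case (elim N)
    have "summable (\<lambda>i. a i N)" using summ bound[OF elim] by (rule summable_comparison_test'[where N = 0])
    thus ?case using a0 by (rule suminf_ennreal2[rotated])
  qed
  ultimately have "(\<lambda>N. \<Sum>i. ennreal (a i N)) \<longlonglongrightarrow> ennreal 0"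
    by (rule tendsto_cong[THEN iffD2, rotated])
  thus ?thesis by (simp add: a_def)
qed

end

theorem corollary3p2:
  fixes lam rho0 :: real and d :: nat
    and G :: "nat \<Rightarrow> ('v, 'w) compat_graph"
    and law_X_inf :: "nat \<Rightarrow> ('v \<Rightarrow> nat) pmf"
  assumes "0 < lam" and "lam < 1" and "d \<ge> 2"
    and "\<And>N. N \<ge> 1 \<Longrightarrow> compatibility_graph (G N)"
    and "\<And>N. N \<ge> 1 \<Longrightarrow> card (servers (G N)) = N"
    and "\<And>N. N \<ge> 1 \<Longrightarrow> rho lam (G N) \<le> rho0" and "rho0 < 1"
    and "\<And>N. N \<ge> 1 \<Longrightarrow>
           stationary_distribution (queue_states (G N)) (queue_rate lam d (G N)) (law_X_inf N)"
    and "(\<lambda>N. max ((phi (G N))\<^sup>2) (gamma (G N))) \<longlonglongrightarrow> 0"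
  shows "(\<lambda>N. \<Sum>i. ennreal (measure_pmf.expectation (law_X_inf N)
            (\<lambda>x. (occupancy (G N) (Suc i) x - q_star lam d (Suc i))\<^sup>2))) \<longlonglongrightarrow> 0"
proof -
  have "(\<lambda>N. (phi (G N))\<^sup>2) \<longlonglongrightarrow> 0"
    by (rule tendsto_sandwich[OF _ _ tendsto_const assms(9)]) auto
  hence "(\<lambda>N. sqrt ((phi (G N))\<^sup>2)) \<longlonglongrightarrow> sqrt 0" by (rule tendsto_real_sqrt)
  hence phi: "(\<lambda>N. phi (G N)) \<longlonglongrightarrow> 0" by (simp add: tendsto_rabs_zero_iff)
  have gamma: "(\<lambda>N. gamma (G N)) \<longlonglongrightarrow> 0"
    by (rule tendsto_sandwich[OF _ _ tendsto_const assms(9)]) (auto simp: gamma_def sum_nonneg)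
  interpret queue_sequence G law_X_inf lam rho0 d
    using assms(1-4,6-8) phi gamma by unfold_locales
  show ?thesis by (rule suminf_sq_deviation_tendsto)
qed

end
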